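(* If a countable standard Borel equivalence relation $\mathcal R$ is treeable (for instance hyperfinite) and freely indecomposable (FI), then it is smooth. In fact, any p.m.p. aperiodic treeable equivalence relation $\mathcal R$ admits a free product decomposition in two pieces $\mathcal R=\mathcal R_1\ast\mathcal R_2$ that is essential, i.e. not inessential.
   Context: Equivalence relations are Borel with countable classes, on Borel subsets of a standard Borel space $X$; in the measured (p.m.p. = probability measure preserving) context, the measure is non-atomic and all definitions and identities are up to null sets. $\mathcal R$ is defined on a Borel set $D(\mathcal R)$, its domain. It is smooth if it admits a Borel fundamental domain (a Borel subset of $D(\mathcal R)$ meeting each class exactly once), and aperiodic if all its classes on $D(\mathcal R)$ are infinite. For $U\subset D(\mathcal R)$, $\mathcal R|U=\mathcal R\cap (U\times U)$. A complete section is a Borel subset of $D(\mathcal R)$ meeting all classes. Free products: a countable family $(\mathcal R_i)_{i\in I}$ with domains $D(\mathcal R_i)\subset X$ is freely independent if there is no sequence $x_1,\dots,x_n$ ($n\ge 2$) with $x_n=x_1$, $x_j\ne x_{j+1}$, $(x_j,x_{j+1})\in\mathcal R_{i_j}$ and $i_j\neq i_{j+1}$ for all consecutive indices. $\mathcal R=\ast_{i\in I}\mathcal R_i$ (free product decomposition) means that the $\mathcal R_i$ are subrelations of $\mathcal R$, freely independent, and generate $\mathcal R$ (in particular $D(\mathcal R)=\bigcup_i D(\mathcal R_i)$). Inessential: a free product decomposition $\mathcal R=\ast_{j\in J}\mathcal R_j$ is inessential if there is a Borel complete section $U$ of $\mathcal R$ with a Borel $\mathcal R|U$-invariant partition $U=\coprod_{j\in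 J}U_j$, $U_j\subset D(\mathcal R_j)$, such that $\mathcal R|U_j=\mathcal R_j|U_j$ for each $j$. FI: $\mathcal R$ is freely indecomposable (FI) if every free product decomposition of $\mathcal R$ (into countably many pieces) is inessential. Treeable: a graphing is a countable family $\Phi=(\varphi_i)$ of partial isomorphisms between Borel subsets; it is a treeing if any equation $\varphi_{i_1}^{\varepsilon_1}\cdots\varphi_{i_n}^{\varepsilon_n}(x)=x$ ($\varepsilon_{i_j}=\pm1$) implies that there is $j$ with $i_j=i_{j+1}$ and $\varepsilon_{i_j}=-\varepsilon_{i_{j+1}}$. A relation is treeable if it is generated by a treeing. *)

theory Defs
  imports "HOL-Probability.Probability"
begin

text \<open>
  A relation is a set of pairs, and its domain \<open>D(R)\<close> is \<open>Field R\<close>; the restriction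
  \<open>R|U\<close> is the library's \<open>Restr R U\<close>. A standard Borel space is a measurable space, that is,
  a \<open>measure\<close> of which only \<open>space\<close> and \<open>sets\<close> are used.
\<close>

definition standard_borel :: "'a measure \<Rightarrow> bool" where
  "standard_borel X \<longleftrightarrow>
     (\<exists>T. completely_metrizable_space T \<and> second_countable T \<and> topspace T = space X
        \<and> sets X = sigma_sets (topspace T) {U. openin T U})"

definition countable_borel_eqrel :: "'a measure \<Rightarrow> 'a rel \<Rightarrow> bool" where
  "countable_borel_eqrel X R \<longleftrightarrow>
     Field R \<in> sets X \<and> equiv (Field R) R \<and> R \<in> sets (X \<Otimes>\<^sub>M X)
     \<and> (\<forall>x\<in>Field R. countable (R `` {x}))"

definition smooth :: "'a measure \<Rightarrow> 'a rel \<Rightarrow> bool" where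
  "smooth X R \<longleftrightarrow>
     (\<exists>F\<in>sets X. F \<subseteq> Field R \<and> (\<forall>x\<in>Field R. \<exists>!y. y \<in> F \<and> (x, y) \<in> R))"

definition aperiodic :: "'a rel \<Rightarrow> bool" where
  "aperiodic R \<longleftrightarrow> (\<forall>x\<in>Field R. infinite (R `` {x}))"

definition complete_section :: "'a measure \<Rightarrow> 'a rel \<Rightarrow> 'a set \<Rightarrow> bool" where
  "complete_section X R U \<longleftrightarrow>
     U \<in> sets X \<and> U \<subseteq> Field R \<and> (\<forall>x\<in>Field R. \<exists>y\<in>U. (x, y) \<in> R)"


section \<open>Free products\<close>

text \<open>The points are \<open>x 1, \<dots>, x n\<close>, the indices \<open>i 1, \<dots>, i (n - 1)\<close>.\<close>

definition freely_independent :: "'i set \<Rightarrow> ('i \<Rightarrow> 'a rel) \<Rightarrow> bool" where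
  "freely_independent I Q \<longleftrightarrow>
     \<not> (\<exists>(n::nat) (x::nat \<Rightarrow> 'a) (i::nat \<Rightarrow> 'i). 2 \<le> n \<and> x n = x 1
          \<and> (\<forall>j. 1 \<le> j \<and> j < n \<longrightarrow>
                i j \<in> I \<and> x j \<noteq> x (j + 1) \<and> (x j, x (j + 1)) \<in> Q (i j))
          \<and> (\<forall>j. 1 \<le> j \<and> j + 1 < n \<longrightarrow> i j \<noteq> i (j + 1)))"

text \<open>
  Since each \<open>Q i\<close> is an equivalence relation on its own domain, the equivalence relation
  generated by the family, on the union of the domains, is the transitive closure of the union.
\<close>

definition free_product_decomposition ::
    "'a measure \<Rightarrow> 'i set \<Rightarrow> ('i \<Rightarrow> 'a rel) \<Rightarrow> 'a rel \<Rightarrow> bool" where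
  "free_product_decomposition X I Q R \<longleftrightarrow>
     countable I
     \<and> (\<forall>i\<in>I. countable_borel_eqrel X (Q i) \<and> Q i \<subseteq> R)
     \<and> freely_independent I Q
     \<and> R = (\<Union>i\<in>I. Q i)\<^sup>+"

definition inessential :: "'a measure \<Rightarrow> 'i set \<Rightarrow> ('i \<Rightarrow> 'a rel) \<Rightarrow> 'a rel \<Rightarrow> bool" where
  "inessential X I Q R \<longleftrightarrow>
     (\<exists>U V. complete_section X R U
        \<and> U = (\<Union>j\<in>I. V j) \<and> disjoint_family_on V I
        \<and> (\<forall>j\<in>I. V j \<in> sets X \<and> V j \<subseteq> Field (Q j)
              \<and> (Restr R U) `` V j \<subseteq> V j
              \<and> Restr R (V j) = Restr (Q j) (V j)))"

text \<open>Up to reindexing, every countable index set is a subset of \<open>nat\<close>.\<close>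

definition freely_indecomposable :: "'a measure \<Rightarrow> 'a rel \<Rightarrow> bool" where
  "freely_indecomposable X R \<longleftrightarrow>
     (\<forall>(I::nat set) Q. free_product_decomposition X I Q R \<longrightarrow> inessential X I Q R)"


section \<open>Graphings and treeings\<close>

text \<open>
  A partial isomorphism is represented by its graph, a bijection from \<open>Domain \<phi>\<close> to \<open>Range \<phi>\<close>
  which is Borel in both directions: \<open>\<phi>\<inverse> `` B\<close> and \<open>\<phi> `` B\<close> are the preimage and the image
  of \<open>B\<close>. Taking \<open>B = space X\<close>, its domain and range are Borel.
\<close>

definition partial_iso :: "'a measure \<Rightarrow> 'a rel \<Rightarrow> bool" where
  "partial_iso X \<phi> \<longleftrightarrow>
     \<phi> \<subseteq> space X \<times> space X \<and> single_valued \<phi> \<and> single_valued (\<phi>\<inverse>)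
     \<and> (\<forall>B\<in>sets X. \<phi>\<inverse> `` B \<in> sets X \<and> \<phi> `` B \<in> sets X)"

definition graphing :: "'a measure \<Rightarrow> 'i set \<Rightarrow> ('i \<Rightarrow> 'a rel) \<Rightarrow> bool" where
  "graphing X I \<Phi> \<longleftrightarrow> countable I \<and> (\<forall>i\<in>I. partial_iso X (\<Phi> i))"

text \<open>
  A word is a list of letters \<open>(i, \<epsilon>)\<close>, with \<open>True\<close> for \<open>\<epsilon> = 1\<close> and \<open>False\<close> for \<open>\<epsilon> = -1\<close>;
  \<open>word_graph\<close> is the graph of the partial map it spells. Maps compose from right to left,
  whereas \<open>r O s\<close> applies \<open>r\<close> first.
\<close>

fun word_graph :: "('i \<Rightarrow> 'a rel) \<Rightarrow> ('i \<times> bool) list \<Rightarrow> 'a rel" where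
  "word_graph \<Phi> [] = Id"
| "word_graph \<Phi> ((i, e) # w) = word_graph \<Phi> w O (if e then \<Phi> i else (\<Phi> i)\<inverse>)"

definition treeing :: "'a measure \<Rightarrow> 'i set \<Rightarrow> ('i \<Rightarrow> 'a rel) \<Rightarrow> bool" where
  "treeing X I \<Phi> \<longleftrightarrow>
     graphing X I \<Phi>
     \<and> (\<forall>w x. w \<noteq> [] \<and> set w \<subseteq> I \<times> UNIV \<and> (x, x) \<in> word_graph \<Phi> w \<longrightarrow>
          (\<exists>j. j + 1 < length w \<and> fst (w ! j) = fst (w ! (j + 1))
               \<and> snd (w ! j) \<noteq> snd (w ! (j + 1))))"

text \<open>
  The right-hand side is the least equivalence relation on \<open>Field R\<close> containing the graphs.
  The term \<open>Id_on (Field R)\<close> allows for points that lie in no domain or range of \<open>\<Phi>\<close>.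
\<close>

definition generated_by :: "'a rel \<Rightarrow> 'i set \<Rightarrow> ('i \<Rightarrow> 'a rel) \<Rightarrow> bool" where
  "generated_by R I \<Phi> \<longleftrightarrow>
     R = Id_on (Field R) \<union> (\<Union>i\<in>I. \<Phi> i \<union> (\<Phi> i)\<inverse>)\<^sup>+"

definition treeable :: "'a measure \<Rightarrow> 'a rel \<Rightarrow> bool" where
  "treeable X R \<longleftrightarrow> (\<exists>(I::nat set) \<Phi>. treeing X I \<Phi> \<and> generated_by R I \<Phi>)"


section \<open>The measured context\<close>

text \<open>On a standard Borel space, a measure is non-atomic iff points are null.\<close>

definition nonatomic :: "'a measure \<Rightarrow> bool" where
  "nonatomic \<mu> \<longleftrightarrow> (\<forall>x\<in>space \<mu>. emeasure \<mu> {x} = 0)"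

definition measure_preserving :: "'a measure \<Rightarrow> 'a rel \<Rightarrow> bool" where
  "measure_preserving \<mu> R \<longleftrightarrow>
     (\<forall>\<phi>. partial_iso \<mu> \<phi> \<and> \<phi> \<subseteq> R \<longrightarrow> emeasure \<mu> (Domain \<phi>) = emeasure \<mu> (Range \<phi>))"

text \<open>
  A p.m.p. relation may have a domain smaller than the ambient probability space (for instance
  after restriction), but not a null one, where every statement up to null sets is void.
\<close>

definition pmp_eqrel :: "'a measure \<Rightarrow> 'a rel \<Rightarrow> bool" where
  "pmp_eqrel \<mu> R \<longleftrightarrow>
     standard_borel \<mu> \<and> prob_space \<mu> \<and> nonatomic \<mu>
     \<and> countable_borel_eqrel \<mu> R \<and> measure_preserving \<mu> R \<and> emeasure \<mu> (Field R) > 0"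

text \<open>
  A property holds up to null sets if it holds after restriction to a Borel, conull and
  \<open>R\<close>-invariant subset of the domain. Invariance is no loss in the presence of a quasi-invariant
  measure, as the saturation of a null set is then null.
\<close>

definition conull_invariant :: "'a measure \<Rightarrow> 'a rel \<Rightarrow> 'a set \<Rightarrow> bool" where
  "conull_invariant \<mu> R Y \<longleftrightarrow>
     Y \<in> sets \<mu> \<and> Y \<subseteq> Field R \<and> R `` Y \<subseteq> Y \<and> emeasure \<mu> (Field R - Y) = 0"

definition ae_aperiodic :: "'a measure \<Rightarrow> 'a rel \<Rightarrow> bool" where
  "ae_aperiodic \<mu> R \<longleftrightarrow> (\<exists>Y. conull_invariant \<mu> R Y \<and> aperiodic (Restr R Y))"

definition ae_treeable :: "'a measure \<Rightarrow> 'a rel \<Rightarrow> bool" where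
  "ae_treeable \<mu> R \<longleftrightarrow> (\<exists>Y. conull_invariant \<mu> R Y \<and> treeable \<mu> (Restr R Y))"

definition ae_free_product_decomposition ::
    "'a measure \<Rightarrow> 'i set \<Rightarrow> ('i \<Rightarrow> 'a rel) \<Rightarrow> 'a rel \<Rightarrow> bool" where
  "ae_free_product_decomposition \<mu> I Q R \<longleftrightarrow>
     (\<exists>Y. conull_invariant \<mu> R Y
        \<and> free_product_decomposition \<mu> I (\<lambda>i. Restr (Q i) Y) (Restr R Y))"

definition ae_inessential :: "'a measure \<Rightarrow> 'i set \<Rightarrow> ('i \<Rightarrow> 'a rel) \<Rightarrow> 'a rel \<Rightarrow> bool" where
  "ae_inessential \<mu> I Q R \<longleftrightarrow>
     (\<exists>Y. conull_invariant \<mu> R Y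
        \<and> inessential \<mu> I (\<lambda>i. Restr (Q i) Y) (Restr R Y))"

end

theory Submission
  imports Defs
begin

text \<open>
  Cutting each generator of a treeing along a countable family of Borel sets that separates points
  turns it into countably many generators \<open>\<psi> k\<close> whose domain and range are disjoint. Then \<open>\<R>\<close> is
  the free product of the relations generated by the single \<open>\<psi> k\<close>, whose classes have at most two
  points; if this decomposition is inessential, then \<open>\<R>\<close> is smooth.

  In the measured case, colour the edges of the forest by \<open>k\<close>, and for a set \<open>S\<close> of colours
  consider the two pieces generated by the colours in \<open>S\<close> and in its complement. If such a
  decomposition is inessential, then almost every tree contains a distinguished connected component
  for one of the two sets of colours. Two such components, for different sets of colours, meet in
  almost every tree, since otherwise one projects to a single point of the other, which would define
  a Borel choice of one point in infinite classes of a finite measure-preserving relation. If all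
  these decompositions were inessential, one would get components for the sets \<open>{n..}\<close>,
  decreasing to a null set, and a set \<open>S\<close> made of sufficiently long alternate blocks of colours
  admits no component compatible with these.
\<close>

section \<open>Forests made of matchings\<close>

text \<open>The index in \<open>nbwalk C x k y\<close> is the colour of the last edge of a walk without backtracking.\<close>

inductive nbwalk :: "('i \<Rightarrow> 'a rel) \<Rightarrow> 'a \<Rightarrow> 'i \<Rightarrow> 'a \<Rightarrow> bool" for C x where
  nbwalk_base: "(x, y) \<in> C k \<Longrightarrow> nbwalk C x k y"
| nbwalk_step: "nbwalk C x k y \<Longrightarrow> (y, z) \<in> C l \<Longrightarrow> l \<noteq> k \<Longrightarrow> nbwalk C x l z"

text \<open>Backtracking could only arise at the junction \<open>y\<close>; since no edge of
  \<open>C' k\<close> leaves \<open>y\<close>, the second walk starts with a colour other than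
  \<open>k\<close>. The smaller family \<open>C'\<close> allows for forests from which edges or
  colours have been removed.\<close>

lemma nbwalk_append:
  assumes "nbwalk C x k y" and "nbwalk C' y l z"
    and "\<And>j. C' j \<subseteq> C j" and "\<And>u. (y, u) \<notin> C' k"
  shows "nbwalk C x l z"
  using assms(2)
proof induction
  case (nbwalk_base z l)
  then show ?case
    using assms(1,3,4) by (metis nbwalk_step subsetD)
next
  case (nbwalk_step l z m u)
  then show ?case
    using assms(3) by (metis nbwalk.nbwalk_step subsetD)
qed

text \<open>A path is reduced edge by edge, keeping track of the last colour. An edge of that same
  colour can only retrace the last step, because a colour is symmetric and single-valued, and then
  the walk is shortened instead.\<close>

lemma rtrancl_imp_nbwalk:
  assumes "\<And>k. sym (C k)" and "\<And>k. single_valued (C k)"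
    and "(x, y) \<in> (\<Union>k. C k)\<^sup>*"
  shows "x = y \<or> (\<exists>k. nbwalk C x k y)"
  using assms(3)
proof induction
  case base
  then show ?case by simp
next
  case (step y z)
  then obtain m where m: "(y, z) \<in> C m" by blast
  from step.IH consider "x = y" | k where "nbwalk C x k y" "k \<noteq> m" | "nbwalk C x m y"
    by blast
  then show ?case
  proof cases
    case 1
    then show ?thesis using m by (blast intro: nbwalk_base)
  next
    case 2
    then show ?thesis using m by (blast intro: nbwalk_step)
  next
    case 3
    \<comment> \<open>Hence the last edge of the walk came from \<open>z\<close>; dropping it leaves
      the trivial walk or a shorter walk ending at \<open>z\<close>.\<close>
    have rev_eq: "u = z" if "(u, y) \<in> C m" for u
      using that m assms(1,2) by (metis single_valuedD symD)
    from 3 show ?thesis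
      by cases (use rev_eq in blast)+
  qed
qed

text \<open>Translation into the sequences of \<open>freely_independent\<close>, indexed from 1:
  \<open>m\<close> edges give \<open>m + 1\<close> points. Irreflexivity supplies the requirement
  that consecutive points differ.\<close>

lemma nbwalk_imp_sequence:
  assumes "nbwalk C x k y" and "\<And>k. irrefl (C k)"
  shows "\<exists>m s i. 1 \<le> m \<and> s 1 = x \<and> s (m + 1) = y \<and> i m = k
           \<and> (\<forall>j. 1 \<le> j \<and> j < m + 1 \<longrightarrow> s j \<noteq> s (j + 1) \<and> (s j, s (j + 1)) \<in> C (i j))
           \<and> (\<forall>j::nat. 1 \<le> j \<and> j + 1 < m + 1 \<longrightarrow> i j \<noteq> i (j + 1))"
  using assms(1)
proof induction
  case (nbwalk_base y k)
  show ?case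
    apply (rule exI[of _ 1], rule exI[of _ "\<lambda>j. if j = 1 then x else y"], rule exI[of _ "\<lambda>_. k"])
    using nbwalk_base assms(2) by (auto simp: irrefl_def less_Suc_eq)
next
  case (nbwalk_step k y z l)
  then obtain m s i where h: "1 \<le> m" "s 1 = x" "s (m + 1) = y" "i m = k"
    "\<And>j. 1 \<le> j \<Longrightarrow> j < m + 1 \<Longrightarrow> s j \<noteq> s (j + 1) \<and> (s j, s (j + 1)) \<in> C (i j)"
    "\<And>j::nat. 1 \<le> j \<Longrightarrow> j + 1 < m + 1 \<Longrightarrow> i j \<noteq> i (j + 1)"
    by blast
  have "y \<noteq> z"
    using nbwalk_step.hyps assms(2) by (metis irreflD)
  show ?case
    apply (rule exI[of _ "m + 1"], rule exI[of _ "s (m + 2 := z)"], rule exI[of _ "i (m + 1 := l)"])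
    using h \<open>y \<noteq> z\<close> nbwalk_step.hyps
    by (auto simp: less_Suc_eq)
qed

lemma freely_independent_no_closed_nbwalk:
  assumes "freely_independent UNIV C" and "\<And>k. irrefl (C k)"
  shows "\<not> nbwalk C x k x"
proof
  assume "nbwalk C x k x"
  from nbwalk_imp_sequence[OF this assms(2)] obtain m s i where h: "1 \<le> m" "s 1 = x" "s (m + 1) = x"
    "\<forall>j. 1 \<le> j \<and> j < m + 1 \<longrightarrow> s j \<noteq> s (j + 1) \<and> (s j, s (j + 1)) \<in> C (i j)"
    "\<forall>j::nat. 1 \<le> j \<and> j + 1 < m + 1 \<longrightarrow> i j \<noteq> i (j + 1)"
    by blast
  have "2 \<le> m + 1 \<and> s (m + 1) = s 1
          \<and> (\<forall>j. 1 \<le> j \<and> j < m + 1 \<longrightarrow>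
                i j \<in> UNIV \<and> s j \<noteq> s (j + 1) \<and> (s j, s (j + 1)) \<in> C (i j))
          \<and> (\<forall>j. 1 \<le> j \<and> j + 1 < m + 1 \<longrightarrow> i j \<noteq> i (j + 1))"
    using h by simp
  with assms(1) show False
    unfolding freely_independent_def by blast
qed

text \<open>A path that visits \<open>x\<close> has a final piece starting at \<open>x\<close>; a
  path that never visits \<open>x\<close> cannot use the edge between \<open>x\<close> and
  \<open>v\<close>.\<close>

lemma relpow_avoid_edge:
  assumes "(u, y) \<in> F ^^ m"
  shows "(u, y) \<in> (F - {(x, v), (v, x)})\<^sup>* \<or> (\<exists>j\<le>m. (x, y) \<in> F ^^ j)"
  using assms
proof (induction m arbitrary: u)
  case 0
  then show ?case by simp
next
  case (Suc m)
  from Suc.prems obtain u' where u': "(u, u') \<in> F" "(u', y) \<in> F ^^ m"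
    by (blast elim: relpow_Suc_E2)
  from Suc.IH[OF u'(2)] consider "\<exists>j\<le>m. (x, y) \<in> F ^^ j"
    | "(u', y) \<in> (F - {(x, v), (v, x)})\<^sup>*" by blast
  then show ?case
  proof cases
    case 1
    then show ?thesis using le_SucI by blast
  next
    case 2
    show ?thesis
    proof (cases "u = x \<or> u' = x")
      case True
      then show ?thesis using u' Suc.prems by (metis le_SucI le_refl)
    next
      case False
      then have "(u, u') \<in> F - {(x, v), (v, x)}" using u' by blast
      with 2 show ?thesis by (meson converse_rtrancl_into_rtrancl)
    qed
  qed
qed

text \<open>The path is stopped at its first visit to \<open>W\<close>, before which no edge has
  both ends in \<open>W\<close>. This produces projections to components.\<close>

lemma rtrancl_first_hit:
  assumes "(x, b) \<in> F\<^sup>*" and "b \<in> W"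
  obtains a where "a \<in> W" and "(x, a) \<in> (F - W \<times> W)\<^sup>*"
proof -
  have "\<exists>a\<in>W. (x, a) \<in> (F - W \<times> W)\<^sup>*"
    using assms(1)
  proof (induction rule: converse_rtrancl_induct)
    case base
    then show ?case using assms(2) by blast
  next
    case (step x x')
    then obtain a where a: "a \<in> W" "(x', a) \<in> (F - W \<times> W)\<^sup>*" by blast
    show ?case
    proof (cases "x \<in> W")
      case False
      then have "(x, x') \<in> F - W \<times> W" using step.hyps by blast
      with a show ?thesis by (meson converse_rtrancl_into_rtrancl)
    qed blast
  qed
  then show ?thesis using that by blast
qed

lemma rtrancl_within_closed:
  assumes "(x, y) \<in> F\<^sup>*" and "F `` P \<subseteq> P" and "x \<in> P"
  shows "y \<in> P" and "(x, y) \<in> (F \<inter> P \<times> P)\<^sup>*"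
proof -
  have "y \<in> P \<and> (x, y) \<in> (F \<inter> P \<times> P)\<^sup>*"
    using assms(1)
  proof induction
    case base
    then show ?case using assms(3) by simp
  next
    case (step y z)
    then have "z \<in> P" using assms(2) by blast
    then have "(y, z) \<in> F \<inter> P \<times> P" using step by blast
    with step \<open>z \<in> P\<close> show ?case by (meson rtrancl.rtrancl_into_rtrancl)
  qed
  then show "y \<in> P" and "(x, y) \<in> (F \<inter> P \<times> P)\<^sup>*" by blast+
qed

section \<open>Forests with properly coloured edges\<close>

locale matching_forest =
  fixes C :: "nat \<Rightarrow> 'a rel"
  assumes sym_C: "sym (C k)"
    and single_valued_C: "single_valued (C k)"
    and irrefl_C: "irrefl (C k)"
    and free_C: "freely_independent UNIV C"
begin

definition edges :: "nat set \<Rightarrow> 'a rel" where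
  "edges S = (\<Union>k\<in>S. C k)"

lemma sym_edges: "sym (edges S)"
  using sym_C unfolding edges_def by (blast intro: symI dest: symD)

lemma edges_mono: "S \<subseteq> T \<Longrightarrow> edges S \<subseteq> edges T"
  unfolding edges_def by blast

lemma no_closed_nbwalk: "\<not> nbwalk C x k x"
  using freely_independent_no_closed_nbwalk[OF free_C irrefl_C] .

text \<open>An edge of two colours could be walked forth in one colour and back in the other, a
  closed walk without backtracking; so every edge has a single colour.\<close>

lemma edges_Int: "edges S \<inter> edges T = edges (S \<inter> T)"
proof -
  have "k = l" if "(x, y) \<in> C k" "(x, y) \<in> C l" for x y k l
  proof (rule ccontr)
    assume "k \<noteq> l"
    then have "nbwalk C x l x"
      using that sym_C[of l] by (metis nbwalk_base nbwalk_step symD)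
    then show False using no_closed_nbwalk by blast
  qed
  then have "(x, y) \<in> edges (S \<inter> T)" if "(x, y) \<in> edges S" "(x, y) \<in> edges T" for x y
    using that unfolding edges_def by blast
  moreover have "edges (S \<inter> T) \<subseteq> edges S \<inter> edges T" unfolding edges_def by blast
  ultimately show ?thesis by auto
qed

text \<open>A path around the edge, reduced and put after the edge itself, would be a closed walk.
  Removing the edge leaves \<open>b\<close> without any edge of its colour \<open>k\<close>, which
  is what \<open>nbwalk_append\<close> requires at the junction.\<close>

lemma edge_not_redundant:
  assumes "(a, b) \<in> edges UNIV"
  shows "(b, a) \<notin> (edges UNIV - {(a, b), (b, a)})\<^sup>*"
proof
  assume path: "(b, a) \<in> (edges UNIV - {(a, b), (b, a)})\<^sup>*"
  from assms obtain k where k: "(a, b) \<in> C k" unfolding edges_def by blast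
  define C' where "C' = (\<lambda>j. C j - {(a, b), (b, a)})"
  have "edges UNIV - {(a, b), (b, a)} = (\<Union>j. C' j)"
    unfolding edges_def C'_def by blast
  moreover have "sym (C' j)" "single_valued (C' j)" for j
    using sym_C[of j] single_valued_C[of j] unfolding C'_def sym_def single_valued_def by blast+
  moreover have "a \<noteq> b" using k irrefl_C by (metis irreflD)
  ultimately obtain l where l: "nbwalk C' b l a"
    using rtrancl_imp_nbwalk[of C' b a] path by metis
  have "(b, u) \<notin> C' k" for u
  proof
    assume "(b, u) \<in> C' k"
    then have "(b, u) \<in> C k" "u \<noteq> a" unfolding C'_def by auto
    moreover have "(b, a) \<in> C k" using k sym_C by (metis symD)
    ultimately show False using single_valued_C by (metis single_valuedD)
  qed
  with nbwalk_append[OF nbwalk_base[of a b C k, OF k] l] have "nbwalk C a l a"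
    unfolding C'_def by blast
  then show False using no_closed_nbwalk by blast
qed

text \<open>Induction on the length of the \<open>F\<close>-path. If its first edge is not in
  \<open>G\<close>, either the path returns to \<open>x\<close> and can be shortened, or its
  remainder together with the \<open>G\<close>-path bypasses that edge, against
  \<open>edge_not_redundant\<close>.\<close>

lemma rtrancl_Int_subforests:
  assumes "F \<subseteq> edges UNIV" "G \<subseteq> edges UNIV" "sym F" "sym G"
    and "(x, y) \<in> F\<^sup>*" "(x, y) \<in> G\<^sup>*"
  shows "(x, y) \<in> (F \<inter> G)\<^sup>*"
proof -
  have "(x, y) \<in> F ^^ n \<Longrightarrow> (x, y) \<in> G\<^sup>* \<Longrightarrow> (x, y) \<in> (F \<inter> G)\<^sup>*" for n
  proof (induction n arbitrary: x rule: less_induct)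
    case (less n)
    show ?case
    proof (cases n)
      case 0
      then show ?thesis using less.prems by simp
    next
      case (Suc m)
      with less.prems obtain x' where x': "(x, x') \<in> F" "(x', y) \<in> F ^^ m"
        by (blast elim: relpow_Suc_E2)
      show ?thesis
      proof (cases "(x, x') \<in> G")
        case True
        then have "(x', y) \<in> G\<^sup>*"
          using less.prems(2) assms(4) by (meson converse_rtrancl_into_rtrancl symD)
        then have "(x', y) \<in> (F \<inter> G)\<^sup>*" using less.IH[of m x'] x' Suc by blast
        then show ?thesis using x' True by (meson IntI converse_rtrancl_into_rtrancl)
      next
        case False
        let ?E = "edges UNIV - {(x, x'), (x', x)}"
        from relpow_avoid_edge[OF x'(2), of x x'] consider j where "j \<le> m" "(x, y) \<in> F ^^ j"
          | "(x', y) \<in> (F - {(x, x'), (x', x)})\<^sup>*" by blast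
        then show ?thesis
        proof cases
          case 1
          then show ?thesis using less.IH[of j x] less.prems(2) Suc by auto
        next
          case 2
          have symE: "sym (?E\<^sup>*)"
            using sym_edges[of UNIV] by (intro sym_rtrancl) (auto simp: sym_def)
          have "(x', y) \<in> ?E\<^sup>*"
            using 2 assms(1) by (meson Diff_mono order_refl rtrancl_mono subsetD)
          moreover have "G \<subseteq> ?E" using False assms(2,4) by (auto dest: symD)
          then have "(x, y) \<in> ?E\<^sup>*" using less.prems(2) rtrancl_mono by blast
          ultimately have "(x', x) \<in> ?E\<^sup>*" using symE by (meson rtrancl_trans symD)
          moreover have "(x, x') \<in> edges UNIV" using x' assms(1) by blast
          ultimately show ?thesis using edge_not_redundant by blast
        qed
      qed
    qed
  qed
  then show ?thesis using assms(5,6) by (metis rtrancl_imp_relpow)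
qed

lemma rtrancl_edges_Int:
  assumes "(x, y) \<in> (edges S)\<^sup>*" "(x, y) \<in> (edges T)\<^sup>*"
  shows "(x, y) \<in> (edges (S \<inter> T))\<^sup>*"
  using rtrancl_Int_subforests[OF edges_mono edges_mono sym_edges sym_edges assms] edges_Int by auto

lemma rtrancl_edges_finite:
  assumes "(x, y) \<in> (edges UNIV)\<^sup>*"
  obtains N where "(x, y) \<in> (edges {..<N})\<^sup>*"
proof -
  have "\<exists>N. (x, y) \<in> (edges {..<N})\<^sup>*"
    using assms
  proof induction
    case base
    then show ?case by blast
  next
    case (step y z)
    then obtain N k where N: "(x, y) \<in> (edges {..<N})\<^sup>*" and k: "(y, z) \<in> C k"
      unfolding edges_def by blast
    have "(x, y) \<in> (edges {..<max N (Suc k)})\<^sup>*"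
      using N rtrancl_mono[OF edges_mono, of "{..<N}" "{..<max N (Suc k)}"] by auto
    moreover have "(y, z) \<in> edges {..<max N (Suc k)}"
      unfolding edges_def using k by force
    ultimately show ?case by (meson rtrancl.rtrancl_into_rtrancl)
  qed
  then show ?thesis using that by blast
qed

lemma rtrancl_edges_imp_nbwalk:
  assumes "(x, y) \<in> (edges S)\<^sup>*" "x \<noteq> y"
  obtains k where "k \<in> S" "nbwalk (\<lambda>k. if k \<in> S then C k else {}) x k y"
proof -
  let ?C = "\<lambda>k. if k \<in> S then C k else {}"
  have "edges S = (\<Union>k. ?C k)" unfolding edges_def by auto
  moreover have "sym (?C k)" "single_valued (?C k)" for k
    using sym_C single_valued_C by (simp_all add: sym_def)
  ultimately obtain k where k: "nbwalk ?C x k y"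
    using rtrancl_imp_nbwalk[of ?C x y] assms by metis
  moreover from k have "k \<in> S" by cases (auto split: if_splits)
  ultimately show ?thesis using that by blast
qed

text \<open>Each step unfolds into a walk within one of two complementary sets of colours.
  Consecutive steps use different sets, so their concatenation never backtracks and a cycle would
  give a closed walk.\<close>

lemma freely_independent_pair:
  assumes "Q (1::nat) \<subseteq> (edges S)\<^sup>*" "Q 2 \<subseteq> (edges (- S))\<^sup>*"
  shows "freely_independent {1, 2} Q"
  unfolding freely_independent_def
proof (rule notI, elim exE conjE)
  fix n :: nat and x :: "nat \<Rightarrow> 'a" and i :: "nat \<Rightarrow> nat"
  assume n: "2 \<le> n" "x n = x 1"
    and step: "\<forall>j. 1 \<le> j \<and> j < n \<longrightarrow> i j \<in> {1, 2} \<and> x j \<noteq> x (j + 1) \<and> (x j, x (j + 1)) \<in> Q (i j)"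
    and alt: "\<forall>j. 1 \<le> j \<and> j + 1 < n \<longrightarrow> i j \<noteq> i (j + 1)"
  define T where "T j = (if i j = 1 then S else - S)" for j
  have T: "\<exists>k\<in>T j. nbwalk (\<lambda>k. if k \<in> T j then C k else {}) (x j) k (x (j + 1))"
    if j: "1 \<le> j" "j < n" for j
  proof -
    have "(x j, x (j + 1)) \<in> (edges (T j))\<^sup>*"
      using step j assms unfolding T_def by fastforce
    moreover have "x j \<noteq> x (j + 1)" using step j by blast
    ultimately show ?thesis by (rule rtrancl_edges_imp_nbwalk) blast
  qed
  have sub: "(\<lambda>k. if k \<in> T j then C k else {}) l \<subseteq> C l" for j l by auto
  have "\<exists>k\<in>T j. nbwalk C (x 1) k (x (j + 1))" if "1 \<le> j" "j < n" for j
    using that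
  proof (induction j rule: nat_induct_at_least)
    case base
    then obtain k where "k \<in> T 1" "nbwalk (\<lambda>k. if k \<in> T 1 then C k else {}) (x 1) k (x (1 + 1))"
      using T by blast
    moreover have "nbwalk C (x 1) k y"
      if "nbwalk (\<lambda>k. if k \<in> T 1 then C k else {}) (x 1) k y" for k y
      using that by induction (use sub[of 1] in \<open>auto intro: nbwalk_base nbwalk_step split: if_splits\<close>)
    ultimately show ?case by blast
  next
    case (Suc j)
    then obtain k where k: "k \<in> T j" "nbwalk C (x 1) k (x (j + 1))" by auto
    obtain l where l: "l \<in> T (Suc j)"
      "nbwalk (\<lambda>k. if k \<in> T (Suc j) then C k else {}) (x (j + 1)) l (x (Suc j + 1))"
      using T[of "Suc j"] Suc by auto
    have "i j \<noteq> i (j + 1)" "i j \<in> {1, 2}" "i (j + 1) \<in> {1, 2}"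
      using alt step Suc by auto
    then have "k \<notin> T (Suc j)" using k unfolding T_def by auto
    then have "nbwalk C (x 1) l (x (Suc j + 1))"
      using nbwalk_append[OF k(2) l(2) sub] by simp
    with l show ?case by blast
  qed
  moreover have "1 \<le> n - 1" "n - 1 < n" "n - 1 + 1 = n" using n(1) by simp_all
  ultimately obtain k where "nbwalk C (x 1) k (x n)" by metis
  then have "nbwalk C (x 1) k (x 1)" using n(2) by simp
  then show False using no_closed_nbwalk by blast
qed

end

section \<open>Partial isomorphisms\<close>

lemma partial_iso_subset_space: "partial_iso X \<phi> \<Longrightarrow> \<phi> \<subseteq> space X \<times> space X"
  and partial_iso_single_valued: "partial_iso X \<phi> \<Longrightarrow> single_valued \<phi>"
  and partial_iso_single_valued_converse: "partial_iso X \<phi> \<Longrightarrow> single_valued (\<phi>\<inverse>)"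
  and partial_iso_image: "partial_iso X \<phi> \<Longrightarrow> B \<in> sets X \<Longrightarrow> \<phi> `` B \<in> sets X"
  and partial_iso_vimage: "partial_iso X \<phi> \<Longrightarrow> B \<in> sets X \<Longrightarrow> \<phi>\<inverse> `` B \<in> sets X"
  unfolding partial_iso_def by blast+

lemma partial_iso_converse: "partial_iso X \<phi> \<Longrightarrow> partial_iso X (\<phi>\<inverse>)"
  unfolding partial_iso_def by auto

lemma partial_iso_empty: "partial_iso X {}"
  unfolding partial_iso_def by simp

lemma partial_iso_Id_on: "A \<in> sets X \<Longrightarrow> partial_iso X (Id_on A)"
proof -
  assume A: "A \<in> sets X"
  then have "Id_on A `` B = A \<inter> B" "(Id_on A)\<inverse> `` B = A \<inter> B" for B by auto
  with A sets.sets_into_space[OF A] show ?thesis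
    unfolding partial_iso_def single_valued_def by auto
qed

lemma partial_iso_relcomp:
  assumes "partial_iso X \<phi>" "partial_iso X \<psi>"
  shows "partial_iso X (\<phi> O \<psi>)"
  unfolding partial_iso_def
proof (intro conjI ballI)
  show "\<phi> O \<psi> \<subseteq> space X \<times> space X"
    using assms[THEN partial_iso_subset_space] by blast
  show "single_valued (\<phi> O \<psi>)"
    using assms[THEN partial_iso_single_valued] by (rule single_valued_relcomp)
  show "single_valued ((\<phi> O \<psi>)\<inverse>)"
    unfolding converse_relcomp
    using assms[THEN partial_iso_single_valued_converse] by (blast intro: single_valued_relcomp)
  show "(\<phi> O \<psi>)\<inverse> `` B \<in> sets X" "(\<phi> O \<psi>) `` B \<in> sets X" if "B \<in> sets X" for B
    using assms that
    by (simp_all add: converse_relcomp relcomp_Image partial_iso_image partial_iso_vimage)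
qed

text \<open>Induction over the generated sigma-algebra, with Borel images and preimages of all
  \<open>B\<close> as the induction property. Complements pass through images because
  \<open>\<phi>\<close> is single-valued in both directions: each point has one partner, so a single
  pair decides membership.\<close>

lemma partial_iso_Int:
  assumes \<phi>: "partial_iso X \<phi>" and G: "G \<in> sets (X \<Otimes>\<^sub>M X)"
  shows "partial_iso X (\<phi> \<inter> G)"
proof -
  have sv: "single_valued (\<phi> \<inter> G)" "single_valued ((\<phi> \<inter> G)\<inverse>)" for G
    using partial_iso_single_valued[OF \<phi>] partial_iso_single_valued_converse[OF \<phi>]
    unfolding single_valued_def by blast+
  have "\<forall>B\<in>sets X. (\<phi> \<inter> G) `` B \<in> sets X \<and> (\<phi> \<inter> G)\<inverse> `` B \<in> sets X"
    using G unfolding sets_pair_measure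
  proof (induction rule: sigma_sets.induct)
    case (Basic G)
    then obtain A A' where A: "A \<in> sets X" "A' \<in> sets X" "G = A \<times> A'" by blast
    have "(\<phi> \<inter> G) `` B = \<phi> `` (B \<inter> A) \<inter> A'" "(\<phi> \<inter> G)\<inverse> `` B = \<phi>\<inverse> `` (B \<inter> A') \<inter> A" for B
      unfolding A(3) by blast+
    then show ?case using A \<phi> by (simp add: partial_iso_image partial_iso_vimage sets.Int)
  next
    case Empty
    then show ?case by simp
  next
    case (Compl G)
    have "(\<phi> \<inter> (space X \<times> space X - G)) `` B = \<phi> `` B - (\<phi> \<inter> G) `` B"
      "(\<phi> \<inter> (space X \<times> space X - G))\<inverse> `` B = \<phi>\<inverse> `` B - (\<phi> \<inter> G)\<inverse> `` B" for B
      using partial_iso_subset_space[OF \<phi>] partial_iso_single_valued[OF \<phi>]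
        partial_iso_single_valued_converse[OF \<phi>]
      unfolding single_valued_def by blast+
    then show ?case
      using Compl.IH \<phi> by (simp add: partial_iso_image partial_iso_vimage sets.Diff)
  next
    case (Union G)
    have "(\<phi> \<inter> (\<Union>n. G n)) `` B = (\<Union>n. (\<phi> \<inter> G n) `` B)"
      "(\<phi> \<inter> (\<Union>n. G n))\<inverse> `` B = (\<Union>n. (\<phi> \<inter> G n)\<inverse> `` B)" for B
      by blast+
    then show ?case using Union.IH by auto
  qed
  then show ?thesis
    using sv[of G] partial_iso_subset_space[OF \<phi>] unfolding partial_iso_def by blast
qed

lemma rtrancl_image_measurable:
  fixes \<theta> :: "nat \<Rightarrow> 'a rel"
  assumes "\<And>k. partial_iso X (\<theta> k)" and "B \<in> sets X"
  shows "(\<Union>k\<in>S. \<theta> k \<union> (\<theta> k)\<inverse>)\<^sup>* `` B \<in> sets X"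
proof -
  let ?F = "\<Union>k\<in>S. \<theta> k \<union> (\<theta> k)\<inverse>"
  have step: "?F `` A \<in> sets X" if "A \<in> sets X" for A
  proof -
    have "?F `` A = (\<Union>k\<in>S. \<theta> k `` A \<union> (\<theta> k)\<inverse> `` A)" by blast
    also have "\<dots> \<in> sets X"
      using that assms(1) by (intro sets.countable_UN') (auto intro: partial_iso_image partial_iso_vimage)
    finally show ?thesis .
  qed
  have "(?F ^^ n) `` B \<in> sets X" for n
    by (induction n) (use assms(2) step in \<open>simp_all add: relcomp_Image\<close>)
  then have "(\<Union>n. (?F ^^ n) `` B) \<in> sets X" by blast
  moreover have "?F\<^sup>* `` B = (\<Union>n. (?F ^^ n) `` B)"
    unfolding rtrancl_is_UN_relpow by blast
  ultimately show ?thesis by simp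
qed

lemma standard_borel_separating:
  assumes "standard_borel X"
  obtains B :: "nat \<Rightarrow> 'a set" where "\<And>n. B n \<in> sets X"
    and "\<And>x y. x \<in> space X \<Longrightarrow> y \<in> space X \<Longrightarrow> x \<noteq> y \<Longrightarrow> \<exists>n. x \<in> B n \<and> y \<notin> B n"
proof -
  from assms obtain T where T: "completely_metrizable_space T" "second_countable T"
    "topspace T = space X" "sets X = sigma_sets (topspace T) {U. openin T U}"
    unfolding standard_borel_def by blast
  from T(2) obtain \<B> where B: "countable \<B>" "\<forall>V\<in>\<B>. openin T V"
    "\<forall>U x. openin T U \<and> x \<in> U \<longrightarrow> (\<exists>V\<in>\<B>. x \<in> V \<and> V \<subseteq> U)"
    unfolding second_countable_def by metis
  have t1: "t1_space T"
    using T(1) completely_metrizable_imp_metrizable_space metrizable_imp_t1_space by blast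
  \<comment> \<open>Adding the empty set makes the family nonempty, so that
    \<open>from_nat_into\<close> enumerates exactly this family.\<close>
  let ?B = "from_nat_into (insert {} \<B>)"
  have range: "range ?B = insert {} \<B>"
    using B(1) by (simp add: range_from_nat_into del: insert_iff)
  show ?thesis
  proof (rule that[of ?B])
    show "?B n \<in> sets X" for n
    proof -
      have "?B n \<in> insert {} \<B>" by (rule from_nat_into) simp
      then have "openin T (?B n)" using B(2) by auto
      then show ?thesis unfolding T(4) by (intro sigma_sets.Basic) simp
    qed
    show "\<exists>n. x \<in> ?B n \<and> y \<notin> ?B n" if "x \<in> space X" "y \<in> space X" "x \<noteq> y" for x y
    proof -
      from t1 that obtain U where "openin T U" "x \<in> U" "y \<notin> U"
        unfolding t1_space_def T(3) by blast
      with B(3) obtain V where "V \<in> \<B>" "x \<in> V" "y \<notin> V" by (metis subsetD)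
      moreover from this range obtain n where "V = ?B n" by blast
      ultimately show ?thesis by blast
    qed
  qed
qed

text \<open>A pair over the domain of \<open>\<phi>\<close> is off the graph exactly when some
  \<open>B n\<close> contains the value of \<open>\<phi>\<close> but not the second coordinate;
  these pairs form the Borel rectangle \<open>N n\<close>.\<close>

lemma partial_iso_measurable_graph:
  assumes X: "standard_borel X" and \<phi>: "partial_iso X \<phi>"
  shows "\<phi> \<in> sets (X \<Otimes>\<^sub>M X)"
proof -
  obtain B :: "nat \<Rightarrow> 'a set" where B: "\<And>n. B n \<in> sets X"
    and sep: "\<And>x y. x \<in> space X \<Longrightarrow> y \<in> space X \<Longrightarrow> x \<noteq> y \<Longrightarrow> \<exists>n. x \<in> B n \<and> y \<notin> B n"
    using standard_borel_separating[OF X] by blast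
  define N where "N n = \<phi>\<inverse> `` B n \<times> (space X - B n)" for n
  have "\<phi> = Domain \<phi> \<times> space X - (\<Union>n. N n)"
  proof (intro equalityI subsetI; clarify)
    fix x y assume xy: "(x, y) \<in> \<phi>"
    then show "(x, y) \<in> Domain \<phi> \<times> space X - (\<Union>n. N n)"
      using partial_iso_subset_space[OF \<phi>] partial_iso_single_valued[OF \<phi>]
      unfolding N_def single_valued_def by blast
  next
    fix x y z assume h: "y \<in> space X" "(x, y) \<notin> (\<Union>n. N n)" "(x, z) \<in> \<phi>"
    have "z = y"
    proof (rule ccontr)
      assume "z \<noteq> y"
      with h sep obtain n where "z \<in> B n" "y \<notin> B n"
        using partial_iso_subset_space[OF \<phi>] by blast
      with h have "(x, y) \<in> N n" unfolding N_def by blast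
      with h show False by blast
    qed
    with h show "(x, y) \<in> \<phi>" by simp
  qed
  moreover have "Domain \<phi> = \<phi>\<inverse> `` space X"
    using partial_iso_subset_space[OF \<phi>] by blast
  then have "Domain \<phi> \<in> sets X" using partial_iso_vimage[OF \<phi>] by simp
  moreover have "N n \<in> sets (X \<Otimes>\<^sub>M X)" for n
    unfolding N_def using B partial_iso_vimage[OF \<phi>] by blast
  ultimately show ?thesis
    using sets.Diff[of "Domain \<phi> \<times> space X" "X \<Otimes>\<^sub>M X" "\<Union>n. N n"] by simp
qed

lemma finite_Image_single_valued:
  assumes "single_valued r" shows "finite (r `` {x})"
proof -
  have "r `` {x} \<subseteq> {THE y. (x, y) \<in> r}"
    using assms unfolding single_valued_def by (auto intro!: the_equality[symmetric])
  then show ?thesis by (rule finite_subset) simp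
qed

section \<open>Borel forests\<close>

locale borel_forest =
  fixes M :: "'a measure" and D :: "'a set" and \<psi> :: "nat \<Rightarrow> 'a rel"
  assumes standard_borel: "standard_borel M"
    and D_measurable: "D \<in> sets M"
    and partial_iso: "partial_iso M (\<psi> k)"
    and subset_D: "\<psi> k \<subseteq> D \<times> D"
    and Domain_Range_disjoint: "Domain (\<psi> k) \<inter> Range (\<psi> k) = {}"
    and free: "freely_independent UNIV (\<lambda>k. \<psi> k \<union> (\<psi> k)\<inverse>)"

text \<open>A cycle made of the cut pieces spells a word of the treeing with a fixed point. The
  cancellation that the treeing then provides makes two consecutive steps traverse the same edge, so
  their colours agree.\<close>

lemma treeable_imp_borel_forest:
  assumes X: "standard_borel X" and R: "equiv (Field R) R" "treeable X R"
    and Y: "Y \<in> sets X" "Y \<subseteq> Field R" "R `` Y \<subseteq> Y"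
  obtains \<psi> :: "nat \<Rightarrow> 'a rel" where "borel_forest X Y \<psi>"
    "Restr R Y = Restr ((\<Union>k. \<psi> k \<union> (\<psi> k)\<inverse>)\<^sup>*) Y"
proof -
  from R(2) obtain I :: "nat set" and \<Phi> where tree: "treeing X I \<Phi>" and gen: "generated_by R I \<Phi>"
    unfolding treeable_def by blast
  have iso: "partial_iso X (\<Phi> i)" if "i \<in> I" for i
    using tree that unfolding treeing_def graphing_def by blast
  have \<Phi>R: "\<Phi> i \<subseteq> R" if "i \<in> I" for i
  proof -
    have "(\<Union>i\<in>I. \<Phi> i \<union> (\<Phi> i)\<inverse>)\<^sup>+ \<subseteq> R"
      using gen unfolding generated_by_def by blast
    moreover have "\<Phi> i \<subseteq> (\<Union>i\<in>I. \<Phi> i \<union> (\<Phi> i)\<inverse>)" using that by blast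
    ultimately show ?thesis by (meson r_into_trancl' subset_iff)
  qed
  have backtrack: "\<exists>j. j + 1 < length w \<and> fst (w ! j) = fst (w ! (j + 1)) \<and> snd (w ! j) \<noteq> snd (w ! (j + 1))"
    if "w \<noteq> []" "set w \<subseteq> I \<times> UNIV" "(x, x) \<in> word_graph \<Phi> w" for w x
    using conjunct2[OF tree[unfolded treeing_def], rule_format, of w x] that by simp
  \<comment> \<open>A word of one letter has no adjacent letters that could cancel.\<close>
  have no_fix: "(x, x) \<notin> \<Phi> i" if "i \<in> I" for i x
    using backtrack[of "[(i, True)]" x] that by auto
  obtain B :: "nat \<Rightarrow> 'a set" where B: "\<And>n. B n \<in> sets X"
    and sep: "\<And>x y. x \<in> space X \<Longrightarrow> y \<in> space X \<Longrightarrow> x \<noteq> y \<Longrightarrow> \<exists>n. x \<in> B n \<and> y \<notin> B n"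
    using standard_borel_separating[OF X] by blast
  \<comment> \<open>\<open>G n\<close> holds the pairs that \<open>B n\<close> separates and no
    earlier set does. These sets are disjoint and cover all pairs of distinct points, so each edge
    of a generator gets exactly one separating index.\<close>
  define G where "G n = B n \<times> (space X - B n) - (\<Union>m<n. B m \<times> (space X - B m))" for n
  have G_disj: "m = n" if "p \<in> G m" "p \<in> G n" for m n p
    using that unfolding G_def by (cases m n rule: linorder_cases) auto
  have G_meas: "G n \<in> sets (X \<Otimes>\<^sub>M X)" for n
    unfolding G_def using B by (intro sets.Diff sets.finite_UN) auto
  \<comment> \<open>A colour \<open>k\<close> encodes a generator \<open>a k\<close> and a
    separating index \<open>m k\<close>.\<close>
  define a where "a k = fst (prod_decode k)" for k
  define m where "m k = snd (prod_decode k)" for k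
  have am: "k = l" if "a k = a l" "m k = m l" for k l
    using that unfolding a_def m_def by (metis prod_decode_inverse prod.collapse)
  define \<psi> where "\<psi> k = (if a k \<in> I then \<Phi> (a k) \<inter> (G (m k) \<inter> Y \<times> Y) else {})" for k
  have \<psi>D: "a k \<in> I" "p \<in> \<Phi> (a k)" "p \<in> G (m k)" if "p \<in> \<psi> k" for p k
    using that unfolding \<psi>_def by (auto split: if_splits)
  have "borel_forest X Y \<psi>"
  proof
    show "partial_iso X (\<psi> k)" for k
      unfolding \<psi>_def using iso G_meas Y(1) by (auto intro!: partial_iso_Int partial_iso_empty)
    show "\<psi> k \<subseteq> Y \<times> Y" for k
      unfolding \<psi>_def by auto
    show "Domain (\<psi> k) \<inter> Range (\<psi> k) = {}" for k
    proof -
      have "\<psi> k \<subseteq> B (m k) \<times> (space X - B (m k))" using \<psi>D(3) unfolding G_def by blast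
      then show ?thesis by blast
    qed
    show "freely_independent UNIV (\<lambda>k. \<psi> k \<union> (\<psi> k)\<inverse>)"
      unfolding freely_independent_def
    proof (rule notI, elim exE conjE)
      fix n :: nat and x :: "nat \<Rightarrow> 'a" and i :: "nat \<Rightarrow> nat"
      assume n: "2 \<le> n" "x n = x 1"
        and "\<forall>j. 1 \<le> j \<and> j < n \<longrightarrow>
               i j \<in> UNIV \<and> x j \<noteq> x (j + 1) \<and> (x j, x (j + 1)) \<in> \<psi> (i j) \<union> (\<psi> (i j))\<inverse>"
        and alt: "\<forall>j. 1 \<le> j \<and> j + 1 < n \<longrightarrow> i j \<noteq> i (j + 1)"
      then have step: "(x j, x (j + 1)) \<in> \<psi> (i j) \<or> (x (j + 1), x j) \<in> \<psi> (i j)" if "1 \<le> j" "j < n" for j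
        using that by auto
      define e where "e j = ((x j, x (j + 1)) \<in> \<psi> (i j))" for j
      define L where "L j = (a (i j), e j)" for j
      \<comment> \<open>The list is reversed because the head of a word acts last in
        \<open>word_graph\<close>.\<close>
      define w where "w t = rev (map L [1..<t])" for t
      have w_Suc: "w (Suc t) = L t # w t" if "1 \<le> t" for t
        using that unfolding w_def by simp
      have "set (w t) \<subseteq> I \<times> UNIV \<and> (x 1, x t) \<in> word_graph \<Phi> (w t)" if "1 \<le> t" "t \<le> n" for t
        using that
      proof (induction t rule: nat_induct_at_least)
        case base
        show ?case by (simp add: w_def)
      next
        case (Suc t)
        then have t: "(x t, x (t + 1)) \<in> \<psi> (i t) \<or> (x (t + 1), x t) \<in> \<psi> (i t)"
          using step[of t] by simp
        then have "a (i t) \<in> I" using \<psi>D by blast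
        moreover have "(x t, x (t + 1)) \<in> (if e t then \<Phi> (a (i t)) else (\<Phi> (a (i t)))\<inverse>)"
          using t \<psi>D(2) unfolding e_def by auto
        moreover have "set (w t) \<subseteq> I \<times> UNIV" "(x 1, x t) \<in> word_graph \<Phi> (w t)"
          using Suc by auto
        ultimately show ?case
          unfolding w_Suc[OF Suc(1)] L_def by (auto simp del: relcomp.simps)
      qed
      from this[of n] n have "set (w n) \<subseteq> I \<times> UNIV" "(x 1, x 1) \<in> word_graph \<Phi> (w n)" by auto
      moreover have "w n \<noteq> []" using n unfolding w_def by simp
      ultimately obtain j where j: "j + 1 < length (w n)" "fst (w n ! j) = fst (w n ! (j + 1))"
        "snd (w n ! j) \<noteq> snd (w n ! (j + 1))"
        using backtrack by blast
      \<comment> \<open>Position \<open>j\<close> of the reversed word is step \<open>p + 1\<close>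
        of the cycle, and position \<open>j + 1\<close> is step \<open>p\<close>.\<close>
      define p where "p = n - 2 - j"
      have len: "length (w n) = n - 1" unfolding w_def by simp
      have p: "1 \<le> p" "p + 1 < n" using j(1) unfolding len p_def by auto
      have nth_w: "w n ! q = L (n - 1 - q)" if "q < n - 1" for q
        using that unfolding w_def by (simp add: rev_nth Suc_diff_Suc)
      have "n - 1 - j = p + 1" "n - 1 - (j + 1) = p" using j(1) unfolding len p_def by auto
      then have "w n ! j = L (p + 1)" "w n ! (j + 1) = L p"
        using nth_w[of j] nth_w[of "j + 1"] j(1) unfolding len by simp_all
      with j have a_eq: "a (i p) = a (i (p + 1))" and e: "e p \<noteq> e (p + 1)"
        unfolding L_def by auto
      have aI: "a (i p) \<in> I" using step[of p] p \<psi>D(1) by auto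
      \<comment> \<open>The two steps use one injective generator in opposite directions, so
        \<open>x p = x (p + 2)\<close> and both traverse the same edge, which lies in only one
        \<open>G n\<close>.\<close>
      have "m (i p) = m (i (p + 1))"
      proof (cases "e p")
        case True
        then have 1: "(x p, x (p + 1)) \<in> \<psi> (i p)" unfolding e_def .
        have 2: "(x (p + 2), x (p + 1)) \<in> \<psi> (i (p + 1))"
          using step[of "p + 1"] p e True unfolding e_def by simp
        have "x p = x (p + 2)"
          using \<psi>D(2)[OF 1] \<psi>D(2)[OF 2] a_eq partial_iso_single_valued_converse[OF iso[OF aI]]
          by (metis converseI single_valuedD)
        then show ?thesis using G_disj \<psi>D(3)[OF 1] \<psi>D(3)[OF 2] by simp
      next
        case False
        then have 1: "(x (p + 1), x p) \<in> \<psi> (i p)" using step[of p] p unfolding e_def by simp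
        have 2: "(x (p + 1), x (p + 2)) \<in> \<psi> (i (p + 1))"
          using e False unfolding e_def by simp
        have "x p = x (p + 2)"
          using \<psi>D(2)[OF 1] \<psi>D(2)[OF 2] a_eq partial_iso_single_valued[OF iso[OF aI]]
          by (metis single_valuedD)
        then show ?thesis using G_disj \<psi>D(3)[OF 1] \<psi>D(3)[OF 2] by simp
      qed
      with a_eq have "i p = i (p + 1)" using am by blast
      with alt p show False by blast
    qed
  qed (use X Y(1) in auto)
  moreover have "Restr R Y = Restr ((\<Union>k. \<psi> k \<union> (\<psi> k)\<inverse>)\<^sup>*) Y" (is "_ = Restr (?E\<^sup>*) Y")
  proof (intro equalityI subrelI)
    fix x y assume "(x, y) \<in> Restr R Y"
    then have xy: "(x, y) \<in> R" "x \<in> Y" "y \<in> Y" by auto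
    have edge: "(y, z) \<in> ?E" if i: "i \<in> I" and yz: "(y, z) \<in> \<Phi> i" "y \<in> Y" "z \<in> Y" for i y z
    proof -
      have "y \<noteq> z" using no_fix[OF i] yz by blast
      moreover have "y \<in> space X" "z \<in> space X" using yz Y(1) sets.sets_into_space by auto
      ultimately have ex: "\<exists>n. y \<in> B n \<and> z \<notin> B n" using sep by blast
      define n where "n = (LEAST n. y \<in> B n \<and> z \<notin> B n)"
      have "y \<in> B n \<and> z \<notin> B n" unfolding n_def using ex by (rule LeastI_ex)
      moreover have "\<not> (y \<in> B l \<and> z \<notin> B l)" if "l < n" for l
        using that unfolding n_def by (rule not_less_Least)
      ultimately have "(y, z) \<in> G n" unfolding G_def using \<open>z \<in> space X\<close> by auto
      then have "(y, z) \<in> \<psi> (prod_encode (i, n))"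
        unfolding \<psi>_def a_def m_def using i yz by simp
      then show ?thesis by blast
    qed
    have "(y, z) \<in> ?E" if i: "i \<in> I" and yz: "(y, z) \<in> \<Phi> i \<union> (\<Phi> i)\<inverse>" "y \<in> Y" "z \<in> Y" for i y z
      using edge[OF i, of y z] edge[OF i, of z y] yz by blast
    moreover have "z \<in> Y" if i: "i \<in> I" and yz: "(y, z) \<in> \<Phi> i \<union> (\<Phi> i)\<inverse>" "y \<in> Y" for i y z
    proof -
      have "(y, z) \<in> R" using yz(1) \<Phi>R[OF i] R(1) unfolding equiv_def sym_def by blast
      then show ?thesis using Y(3) yz by blast
    qed
    \<comment> \<open>Invariance of \<open>Y\<close> keeps a path of generators inside
      \<open>Y\<close>, where each of its edges survives the cutting.\<close>
    ultimately have edge': "z \<in> Y \<and> (y, z) \<in> ?E" if "(y, z) \<in> (\<Union>i\<in>I. \<Phi> i \<union> (\<Phi> i)\<inverse>)" "y \<in> Y" for y z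
      using that by blast
    have "x = y \<or> (x, y) \<in> (\<Union>i\<in>I. \<Phi> i \<union> (\<Phi> i)\<inverse>)\<^sup>+"
      using xy(1) equalityD1[OF gen[unfolded generated_by_def]] by auto
    then have "(x, y) \<in> (\<Union>i\<in>I. \<Phi> i \<union> (\<Phi> i)\<inverse>)\<^sup>*" by (auto dest: trancl_into_rtrancl)
    then have "y \<in> Y \<and> (x, y) \<in> ?E\<^sup>*"
    proof induction
      case base
      then show ?case using xy by simp
    next
      case (step y z)
      then show ?case using edge'[of y z] by (meson rtrancl.rtrancl_into_rtrancl)
    qed
    then show "(x, y) \<in> Restr (?E\<^sup>*) Y" using xy by blast
  next
    fix x y assume "(x, y) \<in> Restr (?E\<^sup>*) Y"
    then have xy: "(x, y) \<in> ?E\<^sup>*" "x \<in> Y" "y \<in> Y" by auto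
    have "\<psi> k \<union> (\<psi> k)\<inverse> \<subseteq> R" for k
    proof -
      have "\<psi> k \<subseteq> R" using \<psi>D(1,2)[of _ k] \<Phi>R[of "a k"] by blast
      then show ?thesis using R(1) unfolding equiv_def sym_def by blast
    qed
    then have E: "?E \<subseteq> R" by blast
    from xy(1) have "(x, y) \<in> R"
    proof induction
      case base
      then show ?case using xy(2) Y(2) R(1) unfolding equiv_def refl_on_def by blast
    next
      case (step y z)
      then show ?case using E R(1) unfolding equiv_def by (meson subsetD transD)
    qed
    then show "(x, y) \<in> Restr R Y" using xy by blast
  qed
  ultimately show ?thesis by (rule that)
qed

section \<open>Orbit relations of colour sets, and smoothness\<close>

context borel_forest
begin

text \<open>No point has both an image and a preimage under \<open>\<psi> k\<close>, so adding the
  converse keeps the relation single-valued and creates no loop.\<close>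

sublocale matching_forest "\<lambda>k. \<psi> k \<union> (\<psi> k)\<inverse>"
proof
  fix k
  show "sym (\<psi> k \<union> (\<psi> k)\<inverse>)" by (simp add: sym_Un_converse)
  show "single_valued (\<psi> k \<union> (\<psi> k)\<inverse>)"
    using partial_iso_single_valued[OF partial_iso, of k]
      partial_iso_single_valued_converse[OF partial_iso, of k] Domain_Range_disjoint[of k]
    unfolding single_valued_def by blast
  show "irrefl (\<psi> k \<union> (\<psi> k)\<inverse>)"
    using Domain_Range_disjoint[of k] unfolding irrefl_def by blast
qed (rule free)

text \<open>\<open>(edges S)\<^sup>*\<close> is reflexive on the whole type. Restricting it gives
  all these relations the same field \<open>D\<close>, with singleton classes at points that no edge
  of \<open>S\<close> touches.\<close>

definition orbit_rel :: "nat set \<Rightarrow> 'a rel" where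
  "orbit_rel S = Restr ((edges S)\<^sup>*) D"

lemma edges_subset: "edges S \<subseteq> D \<times> D"
  using subset_D unfolding edges_def by blast

lemma D_closed: "x \<in> D \<Longrightarrow> (x, y) \<in> (edges S)\<^sup>* \<Longrightarrow> y \<in> D"
  by (erule rtranclE) (use edges_subset in blast)+

lemma sym_rtrancl_edges: "(x, y) \<in> (edges S)\<^sup>* \<Longrightarrow> (y, x) \<in> (edges S)\<^sup>*"
  using sym_rtrancl[OF sym_edges] by (meson symD)

lemma Field_orbit_rel [simp]: "Field (orbit_rel S) = D"
  unfolding orbit_rel_def Field_def by blast

lemma equiv_orbit_rel: "equiv D (orbit_rel S)"
proof (rule equivI)
  show "orbit_rel S \<subseteq> D \<times> D" unfolding orbit_rel_def by blast
  show "refl_on D (orbit_rel S)" unfolding orbit_rel_def refl_on_def by blast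
  show "sym (orbit_rel S)" unfolding orbit_rel_def by (auto intro!: symI sym_rtrancl_edges)
  show "trans (orbit_rel S)"
    unfolding orbit_rel_def by (rule transI) (blast intro: rtrancl_trans)
qed

lemma orbit_rel_mono: "S \<subseteq> T \<Longrightarrow> orbit_rel S \<subseteq> orbit_rel T"
  unfolding orbit_rel_def using rtrancl_mono[OF edges_mono] by blast

lemma word_graph_subset: "set w \<subseteq> S \<times> UNIV \<Longrightarrow> word_graph \<psi> w \<subseteq> (edges S)\<^sup>*"
proof (induction w)
  case Nil
  then show ?case by auto
next
  case (Cons l w)
  obtain k e where l: "l = (k, e)" by force
  have "(if e then \<psi> k else (\<psi> k)\<inverse>) \<subseteq> edges S"
    using Cons.prems unfolding edges_def l by auto
  with Cons show ?case unfolding l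
    by (auto intro: rtrancl.rtrancl_into_rtrancl split: if_splits)
qed

lemma rtrancl_edges_imp_word_graph:
  assumes "(x, y) \<in> (edges S)\<^sup>*"
  shows "\<exists>w. set w \<subseteq> S \<times> UNIV \<and> (x, y) \<in> word_graph \<psi> w"
  using assms
proof induction
  case base
  show ?case by (rule exI[of _ "[]"]) simp
next
  case (step y z)
  then obtain w where w: "set w \<subseteq> S \<times> UNIV" "(x, y) \<in> word_graph \<psi> w" by blast
  from step.hyps(2) obtain k where "k \<in> S" "(y, z) \<in> \<psi> k \<or> (y, z) \<in> (\<psi> k)\<inverse>"
    unfolding edges_def by blast
  then show ?case
  proof (elim disjE)
    assume "(y, z) \<in> \<psi> k"
    then show ?thesis using w \<open>k \<in> S\<close> by (intro exI[of _ "(k, True) # w"]) auto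
  next
    assume "(y, z) \<in> (\<psi> k)\<inverse>"
    then show ?thesis using w \<open>k \<in> S\<close> by (intro exI[of _ "(k, False) # w"]) auto
  qed
qed

lemma partial_iso_word_graph: "partial_iso M (Restr (word_graph \<psi> w) D)"
proof (induction w)
  case Nil
  have "Restr Id D = Id_on D" by auto
  then show ?case using partial_iso_Id_on[OF D_measurable] by simp
next
  case (Cons l w)
  obtain k e where l: "l = (k, e)" by force
  let ?g = "if e then \<psi> k else (\<psi> k)\<inverse>"
  have "?g \<subseteq> D \<times> D" using subset_D[of k] by auto
  then have "Restr (word_graph \<psi> (l # w)) D = Restr (word_graph \<psi> w) D O ?g"
    unfolding l by (simp only: word_graph.simps) blast
  moreover have "partial_iso M ?g"
    using partial_iso[of k] partial_iso_converse[OF partial_iso[of k]] by simp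
  ultimately show ?case using Cons.IH partial_iso_relcomp by metis
qed

text \<open>Words form a countable cover by partial isomorphisms, from which Borelness, countability
  of classes, and Borel or null saturations are read off.\<close>

lemma orbit_rel_eq_word_graphs:
  "orbit_rel S = (\<Union>w\<in>{w. set w \<subseteq> S \<times> UNIV}. Restr (word_graph \<psi> w) D)"
proof (intro equalityI subrelI)
  fix x y assume "(x, y) \<in> orbit_rel S"
  then have "(x, y) \<in> (edges S)\<^sup>*" "x \<in> D" "y \<in> D" unfolding orbit_rel_def by auto
  with rtrancl_edges_imp_word_graph[of x y S]
  show "(x, y) \<in> (\<Union>w\<in>{w. set w \<subseteq> S \<times> UNIV}. Restr (word_graph \<psi> w) D)" by auto
next
  fix x y assume "(x, y) \<in> (\<Union>w\<in>{w. set w \<subseteq> S \<times> UNIV}. Restr (word_graph \<psi> w) D)"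
  then obtain w where "set w \<subseteq> S \<times> UNIV" "(x, y) \<in> word_graph \<psi> w" "x \<in> D" "y \<in> D" by auto
  then show "(x, y) \<in> orbit_rel S"
    using word_graph_subset[of w S] unfolding orbit_rel_def by auto
qed

lemma countable_borel_orbit_rel: "countable_borel_eqrel M (orbit_rel S)"
  unfolding countable_borel_eqrel_def Field_orbit_rel
proof (intro conjI ballI)
  show "orbit_rel S \<in> sets (M \<Otimes>\<^sub>M M)"
    unfolding orbit_rel_eq_word_graphs
    by (intro sets.countable_UN') (auto intro: partial_iso_measurable_graph standard_borel partial_iso_word_graph)
  fix x
  have "countable ((Restr (word_graph \<psi> w) D) `` {x})" for w
    by (intro countable_finite finite_Image_single_valued) (rule partial_iso_single_valued[OF partial_iso_word_graph])
  then have "countable (\<Union>w\<in>{w. set w \<subseteq> S \<times> UNIV}. (Restr (word_graph \<psi> w) D) `` {x})"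
    by (intro countable_UN) auto
  moreover have "orbit_rel S `` {x} = (\<Union>w\<in>{w. set w \<subseteq> S \<times> UNIV}. (Restr (word_graph \<psi> w) D) `` {x})"
    unfolding orbit_rel_eq_word_graphs by blast
  ultimately show "countable (orbit_rel S `` {x})" by simp
qed (use D_measurable equiv_orbit_rel in auto)

lemma trancl_UN_orbit_rel:
  assumes "I \<noteq> {}"
  shows "(\<Union>i\<in>I. orbit_rel (S i))\<^sup>+ = orbit_rel (\<Union>i\<in>I. S i)"
proof (rule equalityI; rule subrelI)
  fix x y assume "(x, y) \<in> (\<Union>i\<in>I. orbit_rel (S i))\<^sup>+"
  moreover have "(\<Union>i\<in>I. orbit_rel (S i)) \<subseteq> orbit_rel (\<Union>i\<in>I. S i)"
    using orbit_rel_mono by (meson UN_least UN_upper)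
  ultimately have "(x, y) \<in> (orbit_rel (\<Union>i\<in>I. S i))\<^sup>+"
    using trancl_mono by blast
  then show "(x, y) \<in> orbit_rel (\<Union>i\<in>I. S i)"
    using equiv_orbit_rel[of "\<Union>i\<in>I. S i"] unfolding equiv_def by (simp add: trancl_id)
next
  fix x y assume "(x, y) \<in> orbit_rel (\<Union>i\<in>I. S i)"
  then have "(x, y) \<in> (edges (\<Union>i\<in>I. S i))\<^sup>*" "x \<in> D" unfolding orbit_rel_def by auto
  then show "(x, y) \<in> (\<Union>i\<in>I. orbit_rel (S i))\<^sup>+"
  proof induction
    case base
    then have "(x, x) \<in> orbit_rel (S i)" for i unfolding orbit_rel_def by blast
    with assms show ?case by blast
  next
    case (step y z)
    then obtain i where "i \<in> I" "(y, z) \<in> edges (S i)" unfolding edges_def by blast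
    then have "(y, z) \<in> (\<Union>i\<in>I. orbit_rel (S i))"
      using edges_subset unfolding orbit_rel_def by blast
    with step show ?case by (meson trancl.trancl_into_trancl)
  qed
qed

text \<open>Since a colour is a matching, a second edge of colour \<open>k\<close> leads back to the
  starting point; classes have at most two points.\<close>

lemma rtrancl_edges_singleton:
  assumes "(x, y) \<in> (edges {k})\<^sup>*"
  shows "x = y \<or> (x, y) \<in> \<psi> k \<or> (y, x) \<in> \<psi> k"
  using assms
proof induction
  case base
  then show ?case by simp
next
  case (step y z)
  have "(y, z) \<in> \<psi> k \<union> (\<psi> k)\<inverse>" using step.hyps unfolding edges_def by simp
  then show ?case
    using step.IH single_valued_C[of k] sym_C[of k] unfolding single_valued_def sym_def by blast
qed

lemma free_product_decomposition_singletons: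
  "free_product_decomposition M UNIV (\<lambda>k. orbit_rel {k}) (orbit_rel UNIV)"
  unfolding free_product_decomposition_def
proof (intro conjI ballI)
  show "orbit_rel UNIV = (\<Union>k. orbit_rel {k})\<^sup>+"
    using trancl_UN_orbit_rel[of UNIV "\<lambda>k. {k}"] by simp
  show "freely_independent UNIV (\<lambda>k. orbit_rel {k})"
    unfolding freely_independent_def
  proof (rule notI, elim exE conjE)
    fix n :: nat and x :: "nat \<Rightarrow> 'a" and i :: "nat \<Rightarrow> nat"
    assume n: "2 \<le> n" "x n = x 1"
      and step: "\<forall>j. 1 \<le> j \<and> j < n \<longrightarrow> i j \<in> UNIV \<and> x j \<noteq> x (j + 1) \<and> (x j, x (j + 1)) \<in> orbit_rel {i j}"
      and alt: "\<forall>j. 1 \<le> j \<and> j + 1 < n \<longrightarrow> i j \<noteq> i (j + 1)"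
    have "\<forall>j. 1 \<le> j \<and> j < n \<longrightarrow> i j \<in> UNIV \<and> x j \<noteq> x (j + 1) \<and> (x j, x (j + 1)) \<in> \<psi> (i j) \<union> (\<psi> (i j))\<inverse>"
    proof (intro allI impI)
      fix j assume "1 \<le> j \<and> j < n"
      with step have "x j \<noteq> x (j + 1)" "(x j, x (j + 1)) \<in> (edges {i j})\<^sup>*"
        unfolding orbit_rel_def by blast+
      with rtrancl_edges_singleton[of "x j" "x (j + 1)" "i j"]
      show "i j \<in> UNIV \<and> x j \<noteq> x (j + 1) \<and> (x j, x (j + 1)) \<in> \<psi> (i j) \<union> (\<psi> (i j))\<inverse>" by auto
    qed
    with n alt free show False unfolding freely_independent_def by blast
  qed
qed (auto intro: countable_borel_orbit_rel orbit_rel_mono[THEN subsetD])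

text \<open>By invariance \<open>U\<close> meets each class within a single \<open>V j\<close>, and
  there in at most two points, joined by \<open>\<psi> j\<close>. The set \<open>F\<close> drops the
  target whenever the source is also present.\<close>

lemma inessential_singletons_imp_smooth:
  assumes "inessential M UNIV (\<lambda>k. orbit_rel {k}) (orbit_rel UNIV)"
  shows "smooth M (orbit_rel UNIV)"
proof -
  let ?R = "orbit_rel UNIV"
  from assms obtain U V where U: "complete_section M ?R U" "U = (\<Union>j. V j)" "disjoint_family V"
    and "\<forall>j\<in>UNIV. V j \<in> sets M \<and> V j \<subseteq> Field (orbit_rel {j}) \<and> Restr ?R U `` V j \<subseteq> V j
              \<and> Restr ?R (V j) = Restr (orbit_rel {j}) (V j)"
    unfolding inessential_def by (elim exE conjE) (rule that, assumption+)
  then have V: "V j \<in> sets M" "Restr ?R U `` V j \<subseteq> V j"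
    "Restr ?R (V j) = Restr (orbit_rel {j}) (V j)" for j
    by simp_all
  have R: "sym ?R" "trans ?R" using equiv_orbit_rel unfolding equiv_def by blast+
  define F where "F = (\<Union>j. V j - \<psi> j `` V j)"
  have F1: "F \<in> sets M"
    unfolding F_def using V(1) partial_iso_image[OF partial_iso] by auto
  have F2: "F \<subseteq> Field ?R"
    using U unfolding F_def complete_section_def by blast
  have F3: "\<forall>x\<in>Field ?R. \<exists>!y. y \<in> F \<and> (x, y) \<in> ?R"
  proof (intro ballI ex_ex1I)
    fix x assume "x \<in> Field ?R"
    with U obtain j u where u: "u \<in> V j" "(x, u) \<in> ?R"
      unfolding complete_section_def by blast
    show "\<exists>y. y \<in> F \<and> (x, y) \<in> ?R"
    proof (cases "u \<in> \<psi> j `` V j")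
      case True
      then obtain v where v: "v \<in> V j" "(v, u) \<in> \<psi> j" by blast
      then have "v \<in> F" using Domain_Range_disjoint[of j] unfolding F_def by blast
      moreover have "(v, u) \<in> ?R"
        using v(2) subset_D[of j] unfolding orbit_rel_def edges_def by blast
      with u R have "(x, v) \<in> ?R" by (meson symD transD)
      ultimately show ?thesis by blast
    next
      case False
      then show ?thesis using u unfolding F_def by blast
    qed
  next
    fix x y z assume yz: "y \<in> F \<and> (x, y) \<in> ?R" "z \<in> F \<and> (x, z) \<in> ?R"
    then obtain j k where jk: "y \<in> V j" "y \<notin> \<psi> j `` V j" "z \<in> V k" "z \<notin> \<psi> k `` V k"
      unfolding F_def by blast
    have "(y, z) \<in> ?R" using yz R by (meson symD transD)
    then have "z \<in> V j" using V(2)[of j] jk U(2) by blast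
    then have "k = j" using U(3) jk(3) unfolding disjoint_family_on_def by blast
    have "(y, z) \<in> Restr ?R (V j)"
      using \<open>(y, z) \<in> ?R\<close> \<open>z \<in> V j\<close> jk(1) by blast
    then have "(y, z) \<in> orbit_rel {j}" unfolding V(3) by blast
    then show "y = z"
      using rtrancl_edges_singleton[of y z j] jk \<open>k = j\<close> unfolding orbit_rel_def by blast
  qed
  from F1 F2 F3 show ?thesis unfolding smooth_def by (intro bexI[of _ F] conjI)
qed

end

lemma treeable_freely_indecomposable_imp_smooth:
  assumes X: "standard_borel X" and R: "countable_borel_eqrel X R" "treeable X R" "freely_indecomposable X R"
  shows "smooth X R"
proof -
  have eq: "equiv (Field R) R" and F: "Field R \<in> sets X"
    using R(1) unfolding countable_borel_eqrel_def by blast+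
  have "R `` Field R \<subseteq> Field R" by (auto intro: FieldI2)
  then obtain \<psi> :: "nat \<Rightarrow> 'a rel" where \<psi>: "borel_forest X (Field R) \<psi>"
    "Restr R (Field R) = Restr ((\<Union>k. \<psi> k \<union> (\<psi> k)\<inverse>)\<^sup>*) (Field R)"
    using treeable_imp_borel_forest[OF X eq R(2) F] by auto
  interpret borel_forest X "Field R" \<psi> by (rule \<psi>)
  have "R = Restr R (Field R)" by (auto simp: Field_def)
  then have "R = orbit_rel UNIV" using \<psi>(2) unfolding orbit_rel_def edges_def by simp
  then show ?thesis
    using R(3) free_product_decomposition_singletons inessential_singletons_imp_smooth
    unfolding freely_indecomposable_def by metis
qed

section \<open>Borel choices of a coloured component in a tree\<close>

context borel_forest
begin

text \<open>In each tree, \<open>P\<close> is either empty or exactly one connected component of the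
  subforest coloured by \<open>S\<close>; thus \<open>P\<close> is a Borel choice of components,
  over possibly many trees.\<close>

definition component :: "nat set \<Rightarrow> 'a set \<Rightarrow> bool" where
  "component S P \<longleftrightarrow> P \<in> sets M \<and> P \<subseteq> D \<and> edges S `` P \<subseteq> P
     \<and> (\<forall>x\<in>P. \<forall>y\<in>P. (x, y) \<in> (edges UNIV)\<^sup>* \<longrightarrow> (x, y) \<in> (edges S)\<^sup>*)"

definition sat :: "'a set \<Rightarrow> 'a set" where
  "sat P = orbit_rel UNIV `` P"

lemma componentD:
  assumes "component S P"
  shows "P \<in> sets M" "P \<subseteq> D" "edges S `` P \<subseteq> P"
    "\<And>x y. x \<in> P \<Longrightarrow> y \<in> P \<Longrightarrow> (x, y) \<in> (edges UNIV)\<^sup>* \<Longrightarrow> (x, y) \<in> (edges S)\<^sup>*"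
  using assms unfolding component_def by blast+

lemma component_closed: "component S P \<Longrightarrow> x \<in> P \<Longrightarrow> (x, y) \<in> (edges S)\<^sup>* \<Longrightarrow> y \<in> P"
  using rtrancl_within_closed(1)[of x y "edges S" P] componentD(3)[of S P] by blast

lemma rtrancl_edges_UNIV: "(x, y) \<in> (edges S)\<^sup>* \<Longrightarrow> (x, y) \<in> (edges UNIV)\<^sup>*"
  using rtrancl_mono[OF edges_mono[of S UNIV]] by blast

lemma orbit_rel_image_measurable:
  assumes "P \<in> sets M"
  shows "orbit_rel S `` P \<in> sets M"
proof -
  have "orbit_rel S `` P = (\<Union>w\<in>{w. set w \<subseteq> S \<times> UNIV}. Restr (word_graph \<psi> w) D `` P)"
    unfolding orbit_rel_eq_word_graphs by blast
  also have "\<dots> \<in> sets M"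
    using assms by (intro sets.countable_UN') (auto intro: partial_iso_image partial_iso_word_graph)
  finally show ?thesis .
qed

lemma sat_measurable: "P \<in> sets M \<Longrightarrow> sat P \<in> sets M"
  unfolding sat_def by (rule orbit_rel_image_measurable)

lemma satI: "x \<in> P \<Longrightarrow> x \<in> D \<Longrightarrow> (x, y) \<in> (edges UNIV)\<^sup>* \<Longrightarrow> y \<in> sat P"
  unfolding sat_def orbit_rel_def using D_closed by blast

lemma satE:
  assumes "y \<in> sat P"
  obtains x where "x \<in> P" "x \<in> D" "y \<in> D" "(x, y) \<in> (edges UNIV)\<^sup>*"
  using assms unfolding sat_def orbit_rel_def by blast

lemma sat_closed: "y \<in> sat P \<Longrightarrow> (y, z) \<in> (edges UNIV)\<^sup>* \<Longrightarrow> z \<in> sat P"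
  by (erule satE) (blast intro: satI rtrancl_trans)

lemma component_Int:
  assumes "component S P" "component T Q"
  shows "component (S \<inter> T) (P \<inter> Q)"
  unfolding component_def
proof (intro conjI ballI impI)
  show "P \<inter> Q \<in> sets M" using assms componentD(1) by blast
  show "P \<inter> Q \<subseteq> D" using assms componentD(2) by blast
  show "edges (S \<inter> T) `` (P \<inter> Q) \<subseteq> P \<inter> Q"
    using componentD(3)[OF assms(1)] componentD(3)[OF assms(2)] unfolding edges_def by blast
  show "(x, y) \<in> (edges (S \<inter> T))\<^sup>*" if "x \<in> P \<inter> Q" "y \<in> P \<inter> Q" "(x, y) \<in> (edges UNIV)\<^sup>*" for x y
    using that componentD(4)[OF assms(1)] componentD(4)[OF assms(2)]
    by (intro rtrancl_edges_Int) auto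
qed

lemma component_UNIV: "component UNIV D"
  unfolding component_def using D_measurable edges_subset by blast

text \<open>This makes a component out of a member \<open>V j\<close> of an inessential
  decomposition: two saturated points of one tree are joined through their representatives in
  \<open>V\<close>, which the hypothesis connects by colours of \<open>S\<close>.\<close>

lemma component_saturation:
  assumes V: "V \<in> sets M" "V \<subseteq> D" "Restr (orbit_rel UNIV) V \<subseteq> orbit_rel S"
  shows "component S (orbit_rel S `` V)"
  unfolding component_def
proof (intro conjI ballI impI)
  show "orbit_rel S `` V \<in> sets M" using V(1) by (rule orbit_rel_image_measurable)
  show "orbit_rel S `` V \<subseteq> D" unfolding orbit_rel_def by blast
  show "edges S `` (orbit_rel S `` V) \<subseteq> orbit_rel S `` V"
    using edges_subset[of S] unfolding orbit_rel_def
    by (auto intro: rtrancl.rtrancl_into_rtrancl)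
  fix x y assume "x \<in> orbit_rel S `` V" "y \<in> orbit_rel S `` V" and xy: "(x, y) \<in> (edges UNIV)\<^sup>*"
  then obtain u v where uv: "u \<in> V" "v \<in> V" and ux: "(u, x) \<in> (edges S)\<^sup>*" and vy: "(v, y) \<in> (edges S)\<^sup>*"
    unfolding orbit_rel_def by blast
  have "(u, v) \<in> (edges UNIV)\<^sup>*"
    using rtrancl_edges_UNIV[OF ux] rtrancl_edges_UNIV[OF sym_rtrancl_edges[OF vy]] xy
    by (meson rtrancl_trans)
  then have "(u, v) \<in> (edges S)\<^sup>*" using uv V(2,3) unfolding orbit_rel_def by blast
  then show "(x, y) \<in> (edges S)\<^sup>*"
    using ux vy sym_rtrancl_edges by (meson rtrancl_trans)
qed

text \<open>Paths without edges inside \<open>P\<close> define the projection to \<open>P\<close>.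
  Deleting those edges amounts to intersecting each \<open>\<psi> k\<close> with a Borel set, which
  keeps it a partial isomorphism.\<close>

lemma edges_off_image_measurable:
  assumes "P \<in> sets M" "B \<in> sets M"
  shows "(edges UNIV - P \<times> P)\<^sup>* `` B \<in> sets M"
proof -
  let ?\<theta> = "\<lambda>k. \<psi> k \<inter> (space M \<times> space M - P \<times> P)"
  have "?\<theta> k = \<psi> k - P \<times> P" for k
    using partial_iso_subset_space[OF partial_iso] by blast
  then have eq: "edges UNIV - P \<times> P = (\<Union>k. ?\<theta> k \<union> (?\<theta> k)\<inverse>)"
    unfolding edges_def by auto
  have "space M \<times> space M - P \<times> P \<in> sets (M \<Otimes>\<^sub>M M)"
    using assms(1) by auto
  then have "partial_iso M (?\<theta> k)" for k
    using partial_iso partial_iso_Int by blast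
  then show ?thesis
    unfolding eq using rtrancl_image_measurable[of M ?\<theta> B UNIV] assms(2) by blast
qed

lemma sym_rtrancl_edges_off:
  "(x, y) \<in> (edges UNIV - P \<times> P)\<^sup>* \<Longrightarrow> (y, x) \<in> (edges UNIV - P \<times> P)\<^sup>*"
proof -
  have "sym (edges UNIV - P \<times> P)" using sym_edges[of UNIV] unfolding sym_def by blast
  then show "(x, y) \<in> (edges UNIV - P \<times> P)\<^sup>* \<Longrightarrow> (y, x) \<in> (edges UNIV - P \<times> P)\<^sup>*"
    using sym_rtrancl by (meson symD)
qed

lemma rtrancl_edges_off: "(x, y) \<in> (edges UNIV - P \<times> P)\<^sup>* \<Longrightarrow> (x, y) \<in> (edges UNIV)\<^sup>*"
  using rtrancl_mono[of "edges UNIV - P \<times> P" "edges UNIV"] by blast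

text \<open>Every point of the forest thus has at most one projection to a component in its tree.\<close>

lemma component_projection_unique:
  assumes "component S P" "x \<in> P" "y \<in> P" "(x, y) \<in> (edges UNIV - P \<times> P)\<^sup>*"
  shows "x = y"
proof -
  have "(x, y) \<in> (edges S)\<^sup>*"
    using assms rtrancl_edges_off componentD(4) by blast
  then have "(x, y) \<in> (edges S \<inter> P \<times> P)\<^sup>*"
    using rtrancl_within_closed(2) componentD(3)[OF assms(1)] assms(2) by metis
  moreover have "sym (edges S \<inter> P \<times> P)" "sym (edges UNIV - P \<times> P)"
    using sym_edges unfolding sym_def by blast+
  moreover have "edges S \<inter> P \<times> P \<subseteq> edges UNIV" using edges_mono[of S UNIV] by blast
  \<comment> \<open>The two points are joined by a path inside \<open>P\<close> and by one without
    edges inside \<open>P\<close>; in a forest the common edges already join them, but there are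
    none.\<close>
  ultimately have "(x, y) \<in> ((edges S \<inter> P \<times> P) \<inter> (edges UNIV - P \<times> P))\<^sup>*"
    using rtrancl_Int_subforests[OF _ Diff_subset _ _ _ assms(4)] by blast
  moreover have "(edges S \<inter> P \<times> P) \<inter> (edges UNIV - P \<times> P) = {}" by blast
  ultimately show ?thesis by simp
qed

end

section \<open>Measure-preserving forests\<close>

locale pmp_forest = borel_forest M D \<psi> + prob_space M
  for M :: "'a measure" and D \<psi> +
  assumes measure_preserving: "measure_preserving M (orbit_rel UNIV)"
    and infinite_orbit: "x \<in> D \<Longrightarrow> infinite (orbit_rel UNIV `` {x})"
begin

lemma emeasure_Domain_eq_Range:
  "partial_iso M \<theta> \<Longrightarrow> \<theta> \<subseteq> orbit_rel UNIV \<Longrightarrow> emeasure M (Domain \<theta>) = emeasure M (Range \<theta>)"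
  using measure_preserving unfolding measure_preserving_def by blast

lemma word_graph_in_orbit_rel: "Restr (word_graph \<psi> w) D \<subseteq> orbit_rel UNIV"
  using orbit_rel_eq_word_graphs[of UNIV] by auto

text \<open>Each word cut down to \<open>N\<close> has a null domain, hence a null range by
  invariance of the measure, and there are countably many words.\<close>

lemma sat_null:
  assumes N: "N \<in> null_sets M"
  shows "sat N \<in> null_sets M"
proof -
  have "Restr (word_graph \<psi> w) D `` N \<in> null_sets M" for w
  proof -
    let ?g = "Restr (word_graph \<psi> w) D"
    let ?\<theta> = "?g \<inter> N \<times> space M"
    have iso: "partial_iso M ?\<theta>"
      using N by (intro partial_iso_Int partial_iso_word_graph) auto
    have "Range ?\<theta> = ?g `` N"
      using partial_iso_subset_space[OF partial_iso_word_graph[of w]] by blast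
    moreover have "Domain ?\<theta> \<in> null_sets M"
    proof (rule null_sets_subset[OF N])
      have "Domain ?\<theta> = ?\<theta>\<inverse> `` space M"
        using partial_iso_subset_space[OF iso] by blast
      then show "Domain ?\<theta> \<in> sets M" using partial_iso_vimage[OF iso] by simp
    qed blast
    moreover have "?\<theta> \<subseteq> orbit_rel UNIV" using word_graph_in_orbit_rel by blast
    ultimately have "emeasure M (?g `` N) = 0"
      using emeasure_Domain_eq_Range[OF iso] by auto
    moreover have "?g `` N \<in> sets M"
      using N by (intro partial_iso_image partial_iso_word_graph) auto
    ultimately show ?thesis by blast
  qed
  moreover have "sat N = (\<Union>w. Restr (word_graph \<psi> w) D `` N)"
    unfolding sat_def orbit_rel_eq_word_graphs by auto
  ultimately show ?thesis by (simp add: null_sets_UN)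
qed

text \<open>
  The saturation of \<open>A\<close> is partitioned into images of subsets of \<open>A\<close>, and every point of \<open>A\<close> lies
  in infinitely many of these subsets, whose measures are summable.
\<close>

lemma partial_transversal_null:
  assumes A: "A \<in> sets M" "A \<subseteq> D"
    and inj: "\<And>x y. x \<in> A \<Longrightarrow> y \<in> A \<Longrightarrow> (x, y) \<in> (edges UNIV)\<^sup>* \<Longrightarrow> x = y"
  shows "A \<in> null_sets M"
proof -
  define g where "g n = Restr (word_graph \<psi> (from_nat n)) D" for n
  have iso_g: "partial_iso M (g n)" for n unfolding g_def by (rule partial_iso_word_graph)
  have g_cover: "\<exists>n. (x, y) \<in> g n" if "(x, y) \<in> orbit_rel UNIV" for x y
  proof -
    from that obtain w :: "(nat \<times> bool) list" where "(x, y) \<in> Restr (word_graph \<psi> w) D"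
      unfolding orbit_rel_eq_word_graphs by auto
    then have "(x, y) \<in> g (to_nat w)" unfolding g_def by simp
    then show ?thesis by blast
  qed
  have g_sub: "g n \<subseteq> orbit_rel UNIV" for n unfolding g_def by (rule word_graph_in_orbit_rel)
  \<comment> \<open>The images are made disjoint: each point of the saturation is charged to the
    first \<open>g n\<close> that reaches it from \<open>A\<close>.\<close>
  define B where "B n = g n `` A - (\<Union>m<n. g m `` A)" for n
  define \<theta> where "\<theta> n = g n \<inter> A \<times> B n" for n
  have B: "B n \<in> sets M" for n
    unfolding B_def using A(1) iso_g by (intro sets.Diff sets.finite_UN) (auto intro: partial_iso_image)
  have iso: "partial_iso M (\<theta> n)" for n
    unfolding \<theta>_def using A(1) B iso_g by (intro partial_iso_Int) auto
  have Dom: "Domain (\<theta> n) \<in> sets M" for n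
  proof -
    have "Domain (\<theta> n) = (\<theta> n)\<inverse> `` space M"
      using partial_iso_subset_space[OF iso[of n]] by blast
    then show ?thesis using partial_iso_vimage[OF iso] by simp
  qed
  have "Range (\<theta> n) = B n" for n unfolding \<theta>_def B_def by blast
  then have "emeasure M (Domain (\<theta> n)) = emeasure M (B n)" for n
    using emeasure_Domain_eq_Range[OF iso[of n]] g_sub[of n] unfolding \<theta>_def by auto
  then have meas_eq: "measure M (Domain (\<theta> n)) = measure M (B n)" for n
    unfolding measure_def by simp
  have "disjoint_family B"
    unfolding disjoint_family_on_def
  proof (intro ballI impI)
    fix m n :: nat assume "m \<noteq> n"
    then show "B m \<inter> B n = {}"
      unfolding B_def by (cases m n rule: linorder_cases) auto
  qed
  then have "(\<lambda>n. measure M (B n)) sums measure M (\<Union>n. B n)"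
    using B by (intro finite_measure_UNION) auto
  then have "summable (\<lambda>n. measure M (Domain (\<theta> n)))"
    unfolding meas_eq by (rule sums_summable)
  then have "AE x in M. eventually (\<lambda>n. x \<in> space M - Domain (\<theta> n)) sequentially"
    using Dom by (intro borel_cantelli_AE1) (simp_all add: less_top[symmetric])
  then have "AE x in M. x \<notin> A"
  proof eventually_elim
    fix x assume "eventually (\<lambda>n. x \<in> space M - Domain (\<theta> n)) sequentially"
    then obtain N where N: "\<And>n. n \<ge> N \<Longrightarrow> x \<notin> Domain (\<theta> n)"
      unfolding eventually_sequentially by blast
    show "x \<notin> A"
    proof
      assume x: "x \<in> A"
      \<comment> \<open>If only the first \<open>N\<close> domains could contain \<open>x\<close>,
        then finitely many single-valued maps would exhaust its infinite class: by
        \<open>inj\<close>, the point of \<open>A\<close> from which \<open>y\<close> is reached can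
        only be \<open>x\<close>.\<close>
      have "orbit_rel UNIV `` {x} \<subseteq> (\<Union>n<N. g n `` {x})"
      proof
        fix y assume "y \<in> orbit_rel UNIV `` {x}"
        then have xy: "(x, y) \<in> orbit_rel UNIV" by blast
        then have ex: "\<exists>n. y \<in> g n `` A" using g_cover x by blast
        define n where "n = (LEAST n. y \<in> g n `` A)"
        have n: "y \<in> g n `` A" unfolding n_def using ex by (rule LeastI_ex)
        have "y \<notin> g m `` A" if "m < n" for m
          using that unfolding n_def by (rule not_less_Least)
        with n have "y \<in> B n" unfolding B_def by blast
        from n obtain x' where x': "x' \<in> A" "(x', y) \<in> g n" by blast
        have "(x, x') \<in> (edges UNIV)\<^sup>*"
          using xy x'(2) g_sub[of n] sym_rtrancl_edges unfolding orbit_rel_def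
          by (blast intro: rtrancl_trans)
        with inj x x' have "x' = x" by blast
        then have "(x, y) \<in> \<theta> n" using x' \<open>y \<in> B n\<close> unfolding \<theta>_def by blast
        with N have "n < N" by (meson DomainI not_le)
        then show "y \<in> (\<Union>n<N. g n `` {x})" using x' \<open>x' = x\<close> by blast
      qed
      moreover have "finite (\<Union>n<N. g n `` {x})"
        using iso_g by (auto intro: finite_Image_single_valued partial_iso_single_valued)
      ultimately show False using infinite_orbit x A(2) by (meson finite_subset subsetD)
    qed
  qed
  then show ?thesis using A(1) by (simp add: AE_iff_null_sets)
qed

text \<open>With the colour \<open>n\<close> alone, \<open>P\<close> has at most two points in each
  tree; removing the target of each pair leaves a partial transversal whose saturation still
  contains \<open>P\<close>.\<close>

lemma component_singleton_null:
  assumes P: "component {n} P"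
  shows "P \<in> null_sets M"
proof -
  define A where "A = P - \<psi> n `` P"
  have PD: "P \<in> sets M" "P \<subseteq> D" using componentD(1,2)[OF P] by blast+
  have "A \<in> null_sets M"
  proof (rule partial_transversal_null)
    show "A \<in> sets M" "A \<subseteq> D"
      unfolding A_def using PD partial_iso_image[OF partial_iso] by auto
    fix x y assume xy: "x \<in> A" "y \<in> A" "(x, y) \<in> (edges UNIV)\<^sup>*"
    then have "(x, y) \<in> (edges {n})\<^sup>*" using componentD(4)[OF P] unfolding A_def by blast
    then show "x = y" using rtrancl_edges_singleton[of x y n] xy unfolding A_def by blast
  qed
  moreover have "P \<subseteq> sat A"
  proof
    fix x assume x: "x \<in> P"
    show "x \<in> sat A"
    proof (cases "x \<in> \<psi> n `` P")
      case True
      then obtain y where y: "y \<in> P" "(y, x) \<in> \<psi> n" by blast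
      then have "y \<in> A" using Domain_Range_disjoint[of n] unfolding A_def by blast
      moreover have "(y, x) \<in> (edges UNIV)\<^sup>*" using y unfolding edges_def by blast
      ultimately show ?thesis using PD(2) y by (blast intro: satI)
    next
      case False
      then show ?thesis using x PD(2) unfolding A_def by (blast intro: satI)
    qed
  qed
  ultimately show ?thesis using sat_null PD(1) null_sets_subset by blast
qed

text \<open>
  In a tree in which \<open>P\<close> and \<open>Q\<close> are disjoint, all points of \<open>Q\<close> have the same projection to \<open>P\<close>;
  these projections form a partial transversal.
\<close>

lemma components_meet:
  assumes P: "component S P" and Q: "component T Q"
  shows "sat P \<inter> sat Q - sat (P \<inter> Q) \<in> null_sets M"
proof -
  define Z where "Z = sat P \<inter> sat Q - sat (P \<inter> Q)"
  define F where "F = edges UNIV - P \<times> P"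
  \<comment> \<open>\<open>A\<close> consists of the projections to \<open>P\<close> of points of
    \<open>Q\<close>, in the trees where \<open>P\<close> and \<open>Q\<close> are both present but
    disjoint.\<close>
  define A where "A = P \<inter> Z \<inter> F\<^sup>* `` Q"
  have PQ: "P \<in> sets M" "P \<subseteq> D" "Q \<in> sets M" "Q \<subseteq> D"
    using componentD(1,2)[OF P] componentD(1,2)[OF Q] by blast+
  have Z: "Z \<in> sets M" unfolding Z_def using PQ by (simp add: sat_measurable sets.Int sets.Diff)
  have Z_closed: "z' \<in> Z" if "z \<in> Z" "(z, z') \<in> (edges UNIV)\<^sup>*" for z z'
    using that sat_closed sym_rtrancl_edges unfolding Z_def by blast
  have PQZ: "P \<inter> Q \<inter> Z = {}"
    unfolding Z_def using PQ(2) by (blast intro: satI)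
  have "A \<in> null_sets M"
  proof (rule partial_transversal_null)
    show "A \<in> sets M"
      unfolding A_def F_def using PQ Z edges_off_image_measurable by blast
    show "A \<subseteq> D" unfolding A_def using PQ by blast
    fix x x' assume xx': "x \<in> A" "x' \<in> A" "(x, x') \<in> (edges UNIV)\<^sup>*"
    then obtain y y' where y: "y \<in> Q" "(y, x) \<in> F\<^sup>*" and y': "y' \<in> Q" "(y', x') \<in> F\<^sup>*"
      unfolding A_def by blast
    have yx: "(y, x) \<in> (edges UNIV)\<^sup>*" "(y', x') \<in> (edges UNIV)\<^sup>*"
      using y y' rtrancl_edges_off unfolding F_def by blast+
    have "(y, y') \<in> (edges UNIV)\<^sup>*"
      using yx xx'(3) sym_rtrancl_edges by (meson rtrancl_trans)
    then have "(y, y') \<in> (edges T)\<^sup>*" using componentD(4)[OF Q] y y' by blast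
    moreover have "edges T `` (Q \<inter> Z) \<subseteq> Q \<inter> Z"
      using componentD(3)[OF Q] Z_closed edges_mono[of T UNIV] by blast
    moreover have "y \<in> Q \<inter> Z"
      using y(1) Z_closed[of x y] sym_rtrancl_edges[OF yx(1)] xx'(1) unfolding A_def by blast
    ultimately have "(y, y') \<in> (edges T \<inter> (Q \<inter> Z) \<times> (Q \<inter> Z))\<^sup>*"
      by (rule rtrancl_within_closed(2))
    \<comment> \<open>Inside \<open>Z\<close> no point of \<open>Q\<close> lies in \<open>P\<close>,
      so a path within \<open>Q\<close> never uses an edge inside \<open>P\<close>.\<close>
    moreover have "edges T \<inter> (Q \<inter> Z) \<times> (Q \<inter> Z) \<subseteq> F"
      using PQZ edges_mono[of T UNIV] unfolding F_def by blast
    ultimately have "(y, y') \<in> F\<^sup>*" using rtrancl_mono by blast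
    then have "(x, x') \<in> F\<^sup>*"
      using y y' sym_rtrancl_edges_off[of y x P] unfolding F_def by (meson rtrancl_trans)
    then show "x = x'"
      using component_projection_unique[OF P] xx' unfolding A_def F_def by blast
  qed
  moreover have "Z \<subseteq> sat A"
  proof
    fix z assume z: "z \<in> Z"
    then obtain p q where p: "p \<in> P" "(p, z) \<in> (edges UNIV)\<^sup>*" and q: "q \<in> Q" "(q, z) \<in> (edges UNIV)\<^sup>*"
      unfolding Z_def by (blast elim: satE)
    have qp: "(q, p) \<in> (edges UNIV)\<^sup>*" using p q sym_rtrancl_edges by (meson rtrancl_trans)
    obtain a where a: "a \<in> P" "(q, a) \<in> F\<^sup>*"
      unfolding F_def using rtrancl_first_hit[OF qp p(1)] .
    then have "(q, a) \<in> (edges UNIV)\<^sup>*" using rtrancl_edges_off unfolding F_def by blast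
    then have az: "(a, z) \<in> (edges UNIV)\<^sup>*" using q sym_rtrancl_edges by (meson rtrancl_trans)
    then have "a \<in> Z" using z Z_closed sym_rtrancl_edges by blast
    then have "a \<in> A" using a q unfolding A_def by blast
    then show "z \<in> sat A" using az a PQ(2) by (blast intro: satI)
  qed
  ultimately have "Z \<in> null_sets M" using sat_null Z null_sets_subset by blast
  then show ?thesis unfolding Z_def .
qed

text \<open>
  Here \<open>B m n\<close> is the set of points whose projection to \<open>W m\<close> lies in \<open>W n\<close>. A component that uses
  no colour in \<open>{f k..<f (Suc k)}\<close> is contained in \<open>B (f k) (f (Suc k))\<close> up to a null set.
\<close>

lemma component_avoiding_gaps_null:
  fixes W :: "nat \<Rightarrow> 'a set" and f :: "nat \<Rightarrow> nat"
  defines "B \<equiv> \<lambda>m n. (edges UNIV - W m \<times> W m)\<^sup>* `` W n"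
  assumes W: "\<And>n. component {n..} (W n)" "decseq W" "\<And>n. D - sat (W n) \<in> null_sets M"
    and f: "strict_mono f" "\<And>k. measure M (B (f k) (f (Suc k))) < (1 / 2) ^ k"
    and P: "component S P" and gaps: "\<And>K. \<exists>k\<ge>K. S \<inter> {f k..<f (Suc k)} = {}"
  shows "P \<in> null_sets M"
proof -
  have WD: "W n \<in> sets M" "W n \<subseteq> D" for n using componentD(1,2)[OF W(1)] by blast+
  have PD: "P \<in> sets M" "P \<subseteq> D" using componentD(1,2)[OF P] by blast+
  have B: "B m n \<in> sets M" for m n
    unfolding B_def using WD(1) by (intro edges_off_image_measurable)
  have "summable (\<lambda>k. measure M (B (f k) (f (Suc k))))"
  proof (rule summable_comparison_test')
    show "summable (\<lambda>k. (1 / 2 :: real) ^ k)" by (rule summable_geometric) simp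
    show "norm (measure M (B (f k) (f (Suc k)))) \<le> (1 / 2) ^ k" if "k \<ge> 0" for k
      using f(2)[of k] by simp
  qed
  then have "AE x in M. eventually (\<lambda>k. x \<in> space M - B (f k) (f (Suc k))) sequentially"
    using B by (intro borel_cantelli_AE1) (simp_all add: less_top[symmetric])
  moreover have "AE x in M. \<forall>n. x \<notin> D - sat (W n)"
    using W(3) by (intro AE_all_countable[THEN iffD2] allI AE_not_in)
  moreover have "AE x in M. \<forall>n. x \<notin> sat P \<inter> sat (W n) - sat (P \<inter> W n)"
    using components_meet[OF P W(1)] by (intro AE_all_countable[THEN iffD2] allI AE_not_in)
  ultimately have "AE x in M. x \<notin> P"
  proof eventually_elim
    case (elim x)
    from elim(1) obtain K where K: "\<And>k. k \<ge> K \<Longrightarrow> x \<notin> B (f k) (f (Suc k))"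
      unfolding eventually_sequentially by blast
    obtain k where k: "k \<ge> K" "S \<inter> {f k..<f (Suc k)} = {}" using gaps by blast
    show "x \<notin> P"
    proof
      assume x: "x \<in> P"
      then have "x \<in> sat P" "x \<in> D" using PD(2) by (blast intro: satI)+
      with elim(2,3) have "x \<in> sat (P \<inter> W (f (Suc k)))" by blast
      then obtain b where b: "b \<in> P" "b \<in> W (f (Suc k))" "(b, x) \<in> (edges UNIV)\<^sup>*"
        by (blast elim: satE)
      have "(x, b) \<in> (edges S)\<^sup>*"
        using componentD(4)[OF P] b x sym_rtrancl_edges by blast
      then have xb: "(x, b) \<in> (edges S \<inter> P \<times> P)\<^sup>*"
        using rtrancl_within_closed(2)[OF _ componentD(3)[OF P] x] by blast
      have bW: "b \<in> W (f k)"
        using b(2) decseqD[OF W(2), of "f k" "f (Suc k)"] strict_monoD[OF f(1), of k "Suc k"] by auto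
      \<comment> \<open>\<open>a\<close> is the projection of \<open>x\<close> to
        \<open>W (f k)\<close>. It is found on a path inside \<open>P\<close>, so it belongs to
        \<open>P\<close> as well.\<close>
      obtain a where a: "a \<in> W (f k)" and xa: "(x, a) \<in> (edges S \<inter> P \<times> P - W (f k) \<times> W (f k))\<^sup>*"
        using rtrancl_first_hit[OF xb bW] .
      have xa_P: "(x, a) \<in> (edges S)\<^sup>*"
        using xa rtrancl_mono[of "edges S \<inter> P \<times> P - W (f k) \<times> W (f k)" "edges S"] by blast
      have xa_W: "(x, a) \<in> (edges UNIV - W (f k) \<times> W (f k))\<^sup>*"
        using xa edges_mono[of S UNIV]
          rtrancl_mono[of "edges S \<inter> P \<times> P - W (f k) \<times> W (f k)" "edges UNIV - W (f k) \<times> W (f k)"]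
        by blast
      have "a \<in> P" using component_closed[OF P x xa_P] .
      have ba: "(b, a) \<in> (edges UNIV)\<^sup>*"
        using b(3) rtrancl_edges_UNIV[OF xa_P] by (rule rtrancl_trans)
      \<comment> \<open>The path from \<open>b\<close> to \<open>a\<close> has only colours of
        \<open>S\<close> from \<open>f k\<close> on. As \<open>S\<close> skips the block, they all
        start from \<open>f (Suc k)\<close>, so \<open>a\<close> lies in
        \<open>W (f (Suc k))\<close> along with \<open>b\<close>, and \<open>x\<close> falls into
        the excluded set \<open>B (f k) (f (Suc k))\<close>.\<close>
      have "(b, a) \<in> (edges S)\<^sup>*" "(b, a) \<in> (edges {f k..})\<^sup>*"
        using componentD(4)[OF P] componentD(4)[OF W(1)] ba b(1) \<open>a \<in> P\<close> bW a by blast+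
      then have "(b, a) \<in> (edges (S \<inter> {f k..}))\<^sup>*" by (rule rtrancl_edges_Int)
      moreover have "S \<inter> {f k..} \<subseteq> {f (Suc k)..}" using k(2) by auto
      ultimately have "(b, a) \<in> (edges {f (Suc k)..})\<^sup>*"
        using rtrancl_mono[OF edges_mono] by blast
      then have "a \<in> W (f (Suc k))" using component_closed[OF W(1) b(2)] by blast
      then have "x \<in> B (f k) (f (Suc k))"
        unfolding B_def using sym_rtrancl_edges_off[OF xa_W] by blast
      with K k(1) show False by blast
    qed
  qed
  then show ?thesis using PD(1) by (simp add: AE_iff_null_sets)
qed

text \<open>
  Otherwise a single colour \<open>n\<close> never carries the component of the pair \<open>{n}, - {n}\<close>, which gives
  components \<open>W n\<close> for the colours \<open>{n..}\<close>, shrinking to a null set. The colours are then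
  distributed in alternating blocks, long enough for Borel--Cantelli to apply.
\<close>

lemma exists_essential_splitting:
  assumes pos: "emeasure M D > 0"
  shows "\<exists>S. \<forall>P Q. component S P \<longrightarrow> component (- S) Q \<longrightarrow> D - sat P - sat Q \<notin> null_sets M"
proof (rule ccontr)
  assume "\<not> ?thesis"
  then have split: "\<exists>P Q. component S P \<and> component (- S) Q \<and> D - sat P - sat Q \<in> null_sets M" for S
    by blast
  have "\<exists>T. component (- {n}) T \<and> D - sat T \<in> null_sets M" for n
  proof -
    from split obtain P Q where PQ: "component {n} P" "component (- {n}) Q" "D - sat P - sat Q \<in> null_sets M"
      by blast
    have "sat P \<in> null_sets M" using sat_null component_singleton_null PQ(1) by blast
    with PQ(3) have "(D - sat P - sat Q) \<union> sat P \<in> null_sets M" by blast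
    then have "D - sat Q \<in> null_sets M"
      by (rule null_sets_subset) (use D_measurable componentD(1)[OF PQ(2)] sat_measurable in auto)
    with PQ(2) show ?thesis by blast
  qed
  then obtain T where T: "\<And>n. component (- {n}) (T n)" "\<And>n. D - sat (T n) \<in> null_sets M" by metis
  \<comment> \<open>The factor \<open>D\<close> makes \<open>W 0 = D\<close>, the component for all
    colours, which starts the induction.\<close>
  define W where "W n = D \<inter> (\<Inter>m<n. T m)" for n
  have W_Suc: "W (Suc n) = W n \<inter> T n" for n
    unfolding W_def by (auto simp: less_Suc_eq)
  have W: "component {n..} (W n) \<and> D - sat (W n) \<in> null_sets M" for n
  proof (induction n)
    case 0
    have "sat D = D"
      unfolding sat_def using equiv_orbit_rel[of UNIV] unfolding equiv_def refl_on_def by blast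
    then show ?case using component_UNIV unfolding W_def by (simp add: atLeast_0)
  next
    case (Suc n)
    have "{n..} \<inter> - {n} = {Suc n..}" by auto
    then have c: "component {Suc n..} (W (Suc n))"
      using component_Int[of "{n..}" "W n" "- {n}" "T n"] Suc T(1) unfolding W_Suc by simp
    have "(D - sat (W n)) \<union> (D - sat (T n)) \<union> (sat (W n) \<inter> sat (T n) - sat (W n \<inter> T n)) \<in> null_sets M"
      using Suc T components_meet by (intro null_sets.Un) blast+
    then have "D - sat (W (Suc n)) \<in> null_sets M"
      by (rule null_sets_subset)
        (use D_measurable componentD(1)[OF c] sat_measurable in \<open>auto simp: W_Suc\<close>)
    with c show ?case by blast
  qed
  then have comp: "\<And>n. component {n..} (W n)" and full: "\<And>n. D - sat (W n) \<in> null_sets M" by blast+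
  have WD: "W n \<in> sets M" "W n \<subseteq> D" for n using componentD(1,2)[OF comp] by blast+
  have dec: "decseq W" unfolding decseq_def W_def by fastforce
  define B where "B m n = (edges UNIV - W m \<times> W m)\<^sup>* `` W n" for m n
  have B: "B m n \<in> sets M" for m n
    unfolding B_def using WD(1) by (intro edges_off_image_measurable)
  have Int_null: "(\<Inter>n. W n) \<in> null_sets M"
  proof (rule partial_transversal_null)
    show "(\<Inter>n. W n) \<in> sets M" using WD(1) by blast
    show "(\<Inter>n. W n) \<subseteq> D" using WD(2) by blast
    fix x y assume xy: "x \<in> (\<Inter>n. W n)" "y \<in> (\<Inter>n. W n)" "(x, y) \<in> (edges UNIV)\<^sup>*"
    \<comment> \<open>A finite path uses only colours below some \<open>N\<close>, while points of
      \<open>W N\<close> in one tree are joined by colours from \<open>N\<close> on; no colour is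
      common.\<close>
    obtain N where "(x, y) \<in> (edges {..<N})\<^sup>*" using rtrancl_edges_finite[OF xy(3)] .
    moreover have "(x, y) \<in> (edges {N..})\<^sup>*"
      using componentD(4)[OF comp[of N]] xy by blast
    ultimately have "(x, y) \<in> (edges ({..<N} \<inter> {N..}))\<^sup>*" by (rule rtrancl_edges_Int)
    moreover have "{..<N} \<inter> {N..} = {}" by auto
    ultimately show "x = y" unfolding edges_def by simp
  qed
  have "(\<Inter>n. B m n) \<in> null_sets M" for m
  proof (rule null_sets_subset[OF sat_null[OF Int_null]])
    show "(\<Inter>n. B m n) \<in> sets M" using B by blast
    show "(\<Inter>n. B m n) \<subseteq> sat (\<Inter>n. W n)"
    proof
      fix x assume x: "x \<in> (\<Inter>n. B m n)"
      then obtain a where a: "a \<in> W m" "(a, x) \<in> (edges UNIV - W m \<times> W m)\<^sup>*"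
        unfolding B_def by blast
      have "a \<in> W n" for n
      proof -
        \<comment> \<open>The index \<open>max m n\<close> puts \<open>b\<close> into
          \<open>W m\<close> as well, so that \<open>b\<close> is also a projection of
          \<open>x\<close> to \<open>W m\<close> and must equal \<open>a\<close>.\<close>
        from x obtain b where b: "b \<in> W (max m n)" "(b, x) \<in> (edges UNIV - W m \<times> W m)\<^sup>*"
          unfolding B_def by blast
        have "W (max m n) \<subseteq> W m" "W (max m n) \<subseteq> W n"
          using dec by (simp_all add: decseqD)
        moreover have "(a, b) \<in> (edges UNIV - W m \<times> W m)\<^sup>*"
          using a(2) sym_rtrancl_edges_off[OF b(2)] by (rule rtrancl_trans)
        ultimately show ?thesis
          using component_projection_unique[OF comp a(1)] b(1) by blast
      qed
      then show "x \<in> sat (\<Inter>n. W n)"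
        using a WD(2) rtrancl_edges_off by (intro satI[of a]) auto
    qed
  qed
  then have "measure M (\<Inter>n. B m n) = 0" for m
    by (simp add: measure_eq_0_null_sets)
  moreover have "(\<lambda>n. measure M (B m n)) \<longlonglongrightarrow> measure M (\<Inter>n. B m n)" for m
  proof (rule finite_Lim_measure_decseq)
    show "decseq (B m)"
      using dec unfolding decseq_def B_def by blast
  qed (use B in auto)
  ultimately have lim: "(\<lambda>n. measure M (B m n)) \<longlonglongrightarrow> 0" for m by simp
  have "\<exists>n>m. measure M (B m n) < (1 / 2) ^ k" for m k
  proof -
    have "eventually (\<lambda>n. measure M (B m n) < (1 / 2) ^ k) sequentially"
      using order_tendstoD(2)[OF lim] by simp
    then have "eventually (\<lambda>n. n > m \<and> measure M (B m n) < (1 / 2) ^ k) sequentially"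
      using eventually_gt_at_top[of m] by eventually_elim simp
    then show ?thesis using eventually_happens by fastforce
  qed
  \<comment> \<open>\<open>True\<close> fills the place of the condition on single values in
    \<open>dependent_nat_choice\<close>; only consecutive values are constrained.\<close>
  then have "\<exists>f. \<forall>k. True \<and> (f k < f (Suc k) \<and> measure M (B (f k) (f (Suc k))) < (1 / 2) ^ k)"
    by (intro dependent_nat_choice) auto
  then obtain f where f: "\<And>k. f k < f (Suc k)" "\<And>k. measure M (B (f k) (f (Suc k))) < (1 / 2) ^ k"
    by blast
  have sm: "strict_mono f" using f(1) by (simp add: strict_mono_Suc_iff)
  \<comment> \<open>\<open>S\<close> omits every odd block and its complement every even one, so
    both have the gaps that \<open>component_avoiding_gaps_null\<close> asks for. Colours below
    \<open>f 0\<close> fall into the complement without affecting this.\<close>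
  define S where "S = (\<Union>k\<in>{k. even k}. {f k..<f (Suc k)})"
  have blocks: "j = k" if "q \<in> {f j..<f (Suc j)}" "q \<in> {f k..<f (Suc k)}" for j k q
  proof -
    have "f j < f (Suc k)" "f k < f (Suc j)" using that by auto
    then show ?thesis using sm by (simp add: strict_mono_less)
  qed
  from split[of S] obtain P Q where PQ: "component S P" "component (- S) Q" "D - sat P - sat Q \<in> null_sets M"
    by blast
  have "P \<in> null_sets M"
  proof (rule component_avoiding_gaps_null[OF comp dec full sm _ PQ(1)])
    show "\<exists>k\<ge>K. S \<inter> {f k..<f (Suc k)} = {}" for K
    proof (intro exI conjI)
      show "S \<inter> {f (2 * K + 1)..<f (Suc (2 * K + 1))} = {}"
      proof (rule ccontr)
        assume "\<not> ?thesis"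
        then obtain q j where "even j" "q \<in> {f j..<f (Suc j)}" "q \<in> {f (2 * K + 1)..<f (Suc (2 * K + 1))}"
          unfolding S_def by blast
        with blocks have "even (2 * K + 1)" by blast
        then show False by simp
      qed
    qed simp
  qed (use f(2) in \<open>simp add: B_def\<close>)
  moreover have "Q \<in> null_sets M"
  proof (rule component_avoiding_gaps_null[OF comp dec full sm _ PQ(2)])
    show "\<exists>k\<ge>K. - S \<inter> {f k..<f (Suc k)} = {}" for K
    proof (intro exI conjI)
      show "- S \<inter> {f (2 * K)..<f (Suc (2 * K))} = {}"
        unfolding S_def by auto
    qed simp
  qed (use f(2) in \<open>simp add: B_def\<close>)
  ultimately have "(D - sat P - sat Q) \<union> sat P \<union> sat Q \<in> null_sets M"
    using PQ(3) sat_null by blast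
  then have "D \<in> null_sets M"
    by (rule null_sets_subset) (use D_measurable in auto)
  with pos show False by auto
qed

end

section \<open>Reduction of the measured statement to a conull invariant set\<close>

lemma conull_invariant_Int:
  assumes "conull_invariant M R Y" "conull_invariant M R Z" "Field R \<in> sets M"
  shows "conull_invariant M R (Y \<inter> Z)"
proof -
  have Y: "Y \<in> sets M" "Y \<subseteq> Field R" "R `` Y \<subseteq> Y" "Field R - Y \<in> null_sets M"
    and Z: "Z \<in> sets M" "Z \<subseteq> Field R" "R `` Z \<subseteq> Z" "Field R - Z \<in> null_sets M"
    using assms unfolding conull_invariant_def by (auto simp: null_sets_def)
  have "(Field R - Y) \<union> (Field R - Z) \<in> null_sets M" using Y Z by blast
  moreover have "Field R - Y \<inter> Z = (Field R - Y) \<union> (Field R - Z)" by blast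
  ultimately show ?thesis using Y Z unfolding conull_invariant_def by auto
qed

text \<open>On a conull invariant set the relation comes from a measure-preserving forest with
  infinite trees. The colours in \<open>S\<close> and \<open>- S\<close> give the two pieces; an
  inessential decomposition would saturate to components present in almost every tree, against the
  choice of \<open>S\<close>.\<close>

lemma pmp_treeable_essential_decomposition:
  assumes R: "pmp_eqrel M R" "ae_aperiodic M R" "ae_treeable M R"
  shows "\<exists>Q. ae_free_product_decomposition M {1::nat, 2} Q R \<and> \<not> ae_inessential M {1, 2} Q R"
proof -
  have M: "standard_borel M" "prob_space M" "measure_preserving M R" "emeasure M (Field R) > 0"
    and F: "Field R \<in> sets M" and eq: "equiv (Field R) R"
    using R(1) unfolding pmp_eqrel_def countable_borel_eqrel_def by blast+
  have R_refl: "(x, x) \<in> R" if "x \<in> Field R" for x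
    using eq that unfolding equiv_def refl_on_def by blast
  from R(2,3) obtain Y0 Y1 where Y0: "conull_invariant M R Y0" "aperiodic (Restr R Y0)"
    and Y1: "conull_invariant M R Y1" "treeable M (Restr R Y1)"
    unfolding ae_aperiodic_def ae_treeable_def by blast
  define Y where "Y = Y0 \<inter> Y1"
  have Y: "conull_invariant M R Y" unfolding Y_def using Y0(1) Y1(1) F by (rule conull_invariant_Int)
  then have Y': "Y \<in> sets M" "Y \<subseteq> Field R" "R `` Y \<subseteq> Y" "emeasure M (Field R - Y) = 0"
    unfolding conull_invariant_def by blast+
  have Field_Restr: "Field (Restr R Z) = Z" if "Z \<subseteq> Field R" for Z
    using that R_refl unfolding Field_def by blast
  have F1: "Field (Restr R Y1) = Y1"
    using Field_Restr Y1(1) unfolding conull_invariant_def by blast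
  have eq1: "equiv Y1 (Restr R Y1)"
    using eq Y1(1) R_refl unfolding conull_invariant_def equiv_def refl_on_def sym_def trans_def by blast
  have eq': "equiv (Field (Restr R Y1)) (Restr R Y1)" using eq1 F1 by simp
  have sub: "Y \<subseteq> Field (Restr R Y1)" unfolding F1 Y_def by blast
  have inv: "Restr R Y1 `` Y \<subseteq> Y" using Y'(3) by blast
  \<comment> \<open>The treeing generates the relation on \<open>Y1\<close>, so it is
    \<open>Restr R Y1\<close> that is cut down to its invariant subset \<open>Y\<close>.\<close>
  obtain \<psi> :: "nat \<Rightarrow> 'a rel" where \<psi>: "borel_forest M Y \<psi>"
    "Restr (Restr R Y1) Y = Restr ((\<Union>k. \<psi> k \<union> (\<psi> k)\<inverse>)\<^sup>*) Y"
    using treeable_imp_borel_forest[OF M(1) eq' Y1(2) Y'(1) sub inv] .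
  interpret borel_forest M Y \<psi> by (rule \<psi>)
  have "Restr (Restr R Y1) Y = Restr R Y" unfolding Y_def by blast
  then have RY: "orbit_rel UNIV = Restr R Y"
    using \<psi>(2) unfolding orbit_rel_def edges_def by simp
  interpret prob_space M by (rule M(2))
  interpret pmp_forest M Y \<psi>
  proof
    show "measure_preserving M (orbit_rel UNIV)"
      using M(3) unfolding RY measure_preserving_def by blast
    show "infinite (orbit_rel UNIV `` {x})" if x: "x \<in> Y" for x
    proof -
      have "x \<in> Field (Restr R Y0)"
        using x Y'(2) R_refl unfolding Y_def Field_def by blast
      then have "infinite (Restr R Y0 `` {x})" using Y0(2) unfolding aperiodic_def by blast
      moreover have "Restr R Y0 `` {x} \<subseteq> orbit_rel UNIV `` {x}"
        unfolding RY using x Y'(3) by blast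
      ultimately show ?thesis using finite_subset by blast
    qed
  qed
  have "emeasure M Y > 0"
  proof -
    have "Field R - Y \<in> null_sets M" using Y'(1,4) F by (auto simp: null_sets_def)
    then have "emeasure M (Field R) = emeasure M (Y \<union> (Field R - Y))"
      using Y'(2) by (simp add: Un_absorb1 Un_Diff_cancel)
    also have "\<dots> = emeasure M Y"
      using Y'(1) \<open>Field R - Y \<in> null_sets M\<close> by (rule emeasure_Un_null_set)
    finally show ?thesis using M(4) by simp
  qed
  then obtain S where S: "\<And>P Q. component S P \<Longrightarrow> component (- S) Q \<Longrightarrow> Y - sat P - sat Q \<notin> null_sets M"
    using exists_essential_splitting by blast
  define Q where "Q i = orbit_rel (if i = (1::nat) then S else - S)" for i
  have Q_Restr: "Restr (Q i) Y = Q i" for i unfolding Q_def orbit_rel_def by blast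
  have "free_product_decomposition M {1, 2} Q (Restr R Y)"
    unfolding free_product_decomposition_def
  proof (intro conjI ballI)
    show "freely_independent {1, 2} Q"
      by (rule freely_independent_pair[of Q S]) (auto simp: Q_def orbit_rel_def)
    have "(\<Union>i\<in>{1, 2}. if i = (1::nat) then S else - S) = UNIV" by auto
    then show "Restr R Y = (\<Union>i\<in>{1, 2}. Q i)\<^sup>+"
      using trancl_UN_orbit_rel[of "{1, 2}" "\<lambda>i. if i = (1::nat) then S else - S"]
      unfolding Q_def RY[symmetric] by simp
    show "Q i \<subseteq> Restr R Y" for i
      unfolding Q_def RY[symmetric] by (rule orbit_rel_mono) simp
    show "countable_borel_eqrel M (Q i)" for i
      unfolding Q_def by (rule countable_borel_orbit_rel)
  qed simp
  then have "ae_free_product_decomposition M {1, 2} Q R"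
    unfolding ae_free_product_decomposition_def using Y Q_Restr by auto
  moreover have "\<not> ae_inessential M {1, 2} Q R"
  proof
    assume "ae_inessential M {1, 2} Q R"
    then obtain Z U V where Z: "conull_invariant M R Z"
      and U: "complete_section M (Restr R Z) U" "U = (\<Union>j\<in>{1, 2}. V j)"
      and V: "\<forall>j\<in>{1, 2}. V j \<in> sets M \<and> V j \<subseteq> Field (Restr (Q j) Z)
              \<and> Restr (Restr R Z) U `` V j \<subseteq> V j
              \<and> Restr (Restr R Z) (V j) = Restr (Restr (Q j) Z) (V j)"
      unfolding ae_inessential_def inessential_def by (elim exE conjE) (rule that, assumption+)
    define P where "P j = orbit_rel (if j = (1::nat) then S else - S) `` V j" for j
    have V': "V j \<subseteq> Y" "component (if j = (1::nat) then S else - S) (P j)" "V j \<subseteq> P j"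
      if j: "j \<in> {1, 2}" for j
    proof -
      have Vj: "V j \<in> sets M" "V j \<subseteq> Field (Restr (Q j) Z)"
        "Restr (Restr R Z) (V j) = Restr (Restr (Q j) Z) (V j)"
        using V j by blast+
      have VQ: "V j \<subseteq> Field (Q j)" "V j \<subseteq> Z" using Vj(2) unfolding Field_def by blast+
      then show VY: "V j \<subseteq> Y" unfolding Q_def Field_orbit_rel by blast
      show "V j \<subseteq> P j" unfolding P_def orbit_rel_def using VY by blast
      have "Restr (orbit_rel UNIV) (V j) \<subseteq> Restr (Restr R Z) (V j)"
        unfolding RY using VQ(2) by blast
      also have "\<dots> \<subseteq> Q j" unfolding Vj(3) by blast
      finally show "component (if j = (1::nat) then S else - S) (P j)"
        unfolding P_def Q_def using Vj(1) VY by (intro component_saturation)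
    qed
    have "component S (P 1)" "component (- S) (P 2)" using V'(2)[of 1] V'(2)[of 2] by simp_all
    \<comment> \<open>A point of \<open>Y\<close> in \<open>Z\<close> is related to some point of
      \<open>U\<close>, hence lies in the saturation of \<open>P 1\<close> or \<open>P 2\<close>;
      what is missed is outside the conull set \<open>Z\<close>.\<close>
    moreover have "Y - sat (P 1) - sat (P 2) \<in> null_sets M"
    proof (rule null_sets_subset)
      show "Field R - Z \<in> null_sets M"
        using Z F unfolding conull_invariant_def by (auto simp: null_sets_def)
      show "Y - sat (P 1) - sat (P 2) \<in> sets M"
        using Y'(1) componentD(1) calculation sat_measurable by blast
      show "Y - sat (P 1) - sat (P 2) \<subseteq> Field R - Z"
      proof (intro subsetI DiffI notI)
        fix x assume x: "x \<in> Y - sat (P 1) - sat (P 2)"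
        then show "x \<in> Field R" using Y'(2) by blast
        assume "x \<in> Z"
        then have "x \<in> Field (Restr R Z)" using x Y'(2) R_refl unfolding Field_def by blast
        then obtain u where u: "u \<in> U" "(x, u) \<in> R"
          using U(1) unfolding complete_section_def by blast
        then obtain j where j: "j \<in> {1, 2}" "u \<in> V j" using U(2) by blast
        then have "u \<in> P j" "u \<in> Y" using V' by blast+
        moreover have "(x, u) \<in> orbit_rel UNIV" unfolding RY using u(2) x \<open>u \<in> Y\<close> by blast
        then have "(u, x) \<in> (edges UNIV)\<^sup>*" unfolding orbit_rel_def using sym_rtrancl_edges by blast
        ultimately have "x \<in> sat (P j)" by (intro satI)
        then show False using x j(1) by auto
      qed
    qed
    ultimately show False using S by blast
  qed
  ultimately show ?thesis by blast
qed

theorem proposition4p6: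
  fixes X :: "'a measure"
  assumes "standard_borel X"
  shows "(\<forall>R. countable_borel_eqrel X R \<and> treeable X R \<and> freely_indecomposable X R
              \<longrightarrow> smooth X R)
       \<and> (\<forall>\<mu> R. sets \<mu> = sets X \<and> pmp_eqrel \<mu> R \<and> ae_aperiodic \<mu> R \<and> ae_treeable \<mu> R
              \<longrightarrow> (\<exists>Q. ae_free_product_decomposition \<mu> {1::nat, 2} Q R
                       \<and> \<not> ae_inessential \<mu> {1, 2} Q R))"
proof (intro conjI allI impI; elim conjE)
  show "smooth X R" if "countable_borel_eqrel X R" "treeable X R" "freely_indecomposable X R" for R
    using treeable_freely_indecomposable_imp_smooth[OF assms] that .
  show "\<exists>Q. ae_free_product_decomposition \<mu> {1::nat, 2} Q R \<and> \<not> ae_inessential \<mu> {1, 2} Q R"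
    if "pmp_eqrel \<mu> R" "ae_aperiodic \<mu> R" "ae_treeable \<mu> R" for \<mu> :: "'a measure" and R
    using pmp_treeable_essential_decomposition that .
qed

end
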